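(* Let $n\ge 1$, let $\mathbb{H}^n$ be the Heisenberg group with homogeneous dimension $Q=2n+2$, and let $\rho(z,t)=(|z|^4+t^2)^{1/4}$. Let $\alpha\in\mathbb{R}$. Then for every (real-valued) $\phi\in C_0^\infty(\mathbb{H}^n\setminus\{(0,0)\})$, $$\int_{\mathbb{H}^n}\rho^{\alpha}|\nabla_{\mathbb{H}^n}\phi|^2\,dz\,dt\ \ge\ \Big(\frac{Q+\alpha-2}{2}\Big)^2\int_{\mathbb{H}^n}\rho^{\alpha}\,\frac{|z|^2}{\rho^4}\,\phi^2\,dz\,dt .$$ Moreover, the constant $\big(\frac{Q+\alpha-2}{2}\big)^2$ is sharp, i.e. it cannot be replaced by any larger constant so that the inequality still holds for all such $\phi$.
   Context: The Heisenberg group $\mathbb{H}^n$ is $\mathbb{C}^n\times\mathbb{R}$, with points $(z,t)$, $z=(z_1,\dots,z_n)$, $z_j=x_j+iy_j$, and group law $(z,t)\circ(z',t')=\big(z+z',\,t+t'+2\sum_{j=1}^n \mathrm{Im}(z_j\overline{z_j'})\big)$. The vector fields are $X_j=\frac{\partial}{\partial x_j}+2y_j\frac{\partial}{\partial t}$ and $Y_j=\frac{\partial}{\partial y_j}-2x_j\frac{\partial}{\partial t}$, $j=1,\dots,n$. The sub-elliptic gradient is $\nabla_{\mathbb{H}^n}=(X_1,\dots,X_n,Y_1,\dots,Y_n)$, and $|\nabla_{\mathbb{H}^n}\phi|^2=\sum_{j=1}^n\big((X_j\phi)^2+(Y_j\phi)^2\big)$. Here $|z|$ is the Euclidean norm of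 $z\in\mathbb{C}^n=\mathbb{R}^{2n}$ and $dz\,dt$ is Lebesgue measure on $\mathbb{R}^{2n+1}$. $C_0^\infty(\mathbb{H}^n\setminus\{(0,0)\})$ denotes smooth functions with compact support contained in $\mathbb{H}^n\setminus\{(0,0)\}$. The value of the left-hand integral is allowed to be $+\infty$. *)

theory Defs
  imports "HOL-Analysis.Analysis"
begin

primrec Ck_on :: "nat \<Rightarrow> 'a::euclidean_space set \<Rightarrow> ('a \<Rightarrow> real) \<Rightarrow> bool" where
  "Ck_on 0 S f \<longleftrightarrow> continuous_on S f"
| "Ck_on (Suc k) S f \<longleftrightarrow>
     (\<forall>x\<in>S. f differentiable (at x)) \<and> (\<forall>v. Ck_on k S (\<lambda>x. frechet_derivative f (at x) v))"

text \<open>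
  The class of smooth functions with compact support contained in an open set \<open>U\<close>. Elements are total
  functions; the support condition forces them to vanish outside \<open>U\<close>, i.e. they are identified
  with their extensions by zero.
\<close>

definition C0_infinity :: "'a::euclidean_space set \<Rightarrow> ('a \<Rightarrow> real) set" where
  "C0_infinity U = {f. (\<forall>k. Ck_on k U f) \<and>
     compact (closure {x. f x \<noteq> 0}) \<and> closure {x. f x \<noteq> 0} \<subseteq> U}"

text \<open>
  The Heisenberg group over \<open>complex ^ 'n\<close>. The norm of \<open>complex ^ 'n\<close> is the Euclidean norm of
  the real vector space of dimension \<open>2 * CARD('n)\<close>, and \<open>lborel\<close> on the product
  is Lebesgue measure in the real coordinates \<open>x\<^sub>j, y\<^sub>j, t\<close>.
\<close>

type_synonym 'n heis = "(complex ^ 'n) \<times> real"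

definition heis_mult :: "'n::finite heis \<Rightarrow> 'n heis \<Rightarrow> 'n heis" where
  "heis_mult p q =
     (fst p + fst q, snd p + snd q + 2 * (\<Sum>j\<in>UNIV. Im (fst p $ j * cnj (fst q $ j))))"

definition heis_norm :: "'n::finite heis \<Rightarrow> real" where
  "heis_norm p = (norm (fst p) ^ 4 + snd p ^ 2) powr (1 / 4)"

definition partial_x :: "'n \<Rightarrow> ('n::finite heis \<Rightarrow> real) \<Rightarrow> 'n heis \<Rightarrow> real" where
  "partial_x j f p = frechet_derivative f (at p) (axis j 1, 0)"

definition partial_y :: "'n \<Rightarrow> ('n::finite heis \<Rightarrow> real) \<Rightarrow> 'n heis \<Rightarrow> real" where
  "partial_y j f p = frechet_derivative f (at p) (axis j \<i>, 0)"

definition partial_t :: "('n::finite heis \<Rightarrow> real) \<Rightarrow> 'n heis \<Rightarrow> real" where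
  "partial_t f p = frechet_derivative f (at p) (0, 1)"

definition heis_X :: "'n \<Rightarrow> ('n::finite heis \<Rightarrow> real) \<Rightarrow> 'n heis \<Rightarrow> real" where
  "heis_X j f p = partial_x j f p + 2 * Im (fst p $ j) * partial_t f p"

definition heis_Y :: "'n \<Rightarrow> ('n::finite heis \<Rightarrow> real) \<Rightarrow> 'n heis \<Rightarrow> real" where
  "heis_Y j f p = partial_y j f p - 2 * Re (fst p $ j) * partial_t f p"

definition heis_grad :: "('n::finite heis \<Rightarrow> real) \<Rightarrow> 'n heis \<Rightarrow> (real ^ 'n) \<times> (real ^ 'n)" where
  "heis_grad f p = ((\<chi> j. heis_X j f p), (\<chi> j. heis_Y j f p))"

lemma norm_heis_grad_sq:
  "(norm (heis_grad f p))\<^sup>2 = (\<Sum>j\<in>UNIV. (heis_X j f p)\<^sup>2 + (heis_Y j f p)\<^sup>2)"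
  by (simp add: heis_grad_def norm_prod_def norm_vec_def L2_set_def sum_nonneg sum.distrib)

text \<open>
  The fields are the left-invariant ones: they differentiate along right translation by the
  one-parameter subgroups in the directions \<open>x\<^sub>j\<close> and \<open>y\<^sub>j\<close>.
\<close>

lemma heis_mult_x_direction:
  "heis_mult p (s *\<^sub>R axis j 1, 0) = p + s *\<^sub>R (axis j 1, 2 * Im (fst p $ j))"
proof -
  have "(\<Sum>i\<in>UNIV. Im (fst p $ i * cnj ((s *\<^sub>R axis j 1) $ i)))
      = (\<Sum>i\<in>UNIV. if i = j then s * Im (fst p $ j) else 0)"
    by (intro sum.cong) (auto simp: axis_def)
  then show ?thesis
    by (simp add: heis_mult_def prod_eq_iff)
qed

lemma heis_mult_y_direction:
  "heis_mult p (s *\<^sub>R axis j \<i>, 0) = p + s *\<^sub>R (axis j \<i>, - 2 * Re (fst p $ j))"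
proof -
  have "(\<Sum>i\<in>UNIV. Im (fst p $ i * cnj ((s *\<^sub>R axis j \<i>) $ i)))
      = (\<Sum>i\<in>UNIV. if i = j then - s * Re (fst p $ j) else 0)"
    by (intro sum.cong) (auto simp: axis_def)
  then show ?thesis
    by (simp add: heis_mult_def prod_eq_iff)
qed

text \<open>
  Both integrals of the weighted Hardy inequality have nonnegative integrands and are taken with
  values in \<open>[0, \<infinity>]\<close>. The junk values at the origin (\<open>0 powr \<alpha> = 0\<close>, \<open>x / 0 = 0\<close>)
  concern a null set.
\<close>

definition hardy_energy :: "real \<Rightarrow> ('n::finite heis \<Rightarrow> real) \<Rightarrow> ennreal" where
  "hardy_energy \<alpha> \<phi> =
     (\<integral>\<^sup>+ p. ennreal (heis_norm p powr \<alpha> * (norm (heis_grad \<phi> p))\<^sup>2) \<partial>lborel)"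

definition hardy_potential :: "real \<Rightarrow> ('n::finite heis \<Rightarrow> real) \<Rightarrow> ennreal" where
  "hardy_potential \<alpha> \<phi> =
     (\<integral>\<^sup>+ p. ennreal (heis_norm p powr \<alpha> * ((norm (fst p))\<^sup>2 / heis_norm p ^ 4) * (\<phi> p)\<^sup>2)
        \<partial>lborel)"

end

theory Submission
  imports Defs
begin

text \<open>
  Write \<open>N = |z|\<^sup>4 + t\<^sup>2 = \<rho>\<^sup>4\<close> and \<open>c = (Q + \<alpha> - 2) / 2 = (2 n + \<alpha>) / 2\<close>.

  For the inequality, let \<open>G\<close> be a quarter of the horizontal gradient of \<open>N\<close>. It satisfies
  \<open>|G|\<^sup>2 = |z|\<^sup>2 N\<close>, and, crucially, \<open>\<nabla>\<phi> \<bullet> G = |z|\<^sup>2 E\<phi> + t R\<phi>\<close>, where \<open>E(z, t) = (z, 2 t)\<close> generates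
  the Heisenberg dilations and \<open>R(z, t) = (- i z, 0)\<close> generates the simultaneous rotation of all \<open>z\<^sub>j\<close>.
  Expanding the square in \<open>0 \<le> \<rho>\<^sup>\<alpha> |\<nabla>\<phi> + c \<phi> G / N|\<^sup>2\<close> bounds the energy density from below by the
  potential density with factor \<open>- c\<^sup>2\<close> and a cross term. The cross term
  consists of derivatives along \<open>E\<close> and \<open>R\<close>, up to a multiple of the potential density.
  A linear field \<open>A\<close> obeys
  \<open>\<integral> A F = - tr A \<integral> F\<close> for every compactly supported \<open>C\<^sup>1\<close> function \<open>F\<close>
  (\<open>integral_linear_field_derivative\<close>). The traces are
  \<open>Q\<close> and \<open>0\<close>, and \<open>R\<close> annihilates \<open>N\<close> and \<open>t\<close>. So the cross term integrates to \<open>2 c\<^sup>2\<close> times the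
  potential, which leaves the constant \<open>2 c\<^sup>2 - c\<^sup>2 = c\<^sup>2\<close>.

  For sharpness, the virtual extremal is \<open>\<rho>\<close> to the power \<open>- c\<close>, which has to be cut off. Put \<open>L = ln \<rho>\<close> and
  \<open>\<phi> = exp (- c L) u(L)\<close>. Then the energy is \<open>\<integral> (u'(L) - c u(L))\<^sup>2 d\<nu>\<close> and the potential is
  \<open>\<integral> u(L)\<^sup>2 d\<nu>\<close>, where \<open>\<nu>\<close> has density \<open>|z|\<^sup>2\<close> times \<open>\<rho>\<close> to the power \<open>- Q - 2\<close>. This
  measure is invariant under dilations. Hence all the shells \<open>{i \<le> L < i + 1}\<close> have the same mass, and
  that mass is positive and finite (\<open>emeasure_shell_shift\<close>, \<open>emeasure_shell_pos\<close>,
  \<open>emeasure_shell_finite\<close>). If \<open>u\<close> is a smooth plateau that equals \<open>1\<close> on \<open>[0, k]\<close> and descends to \<open>0\<close> within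
  unit distance, the \<open>k\<close> plateau shells contribute the ratio \<open>c\<^sup>2\<close>, and the two
  transition shells contribute an amount independent of \<open>k\<close>. Letting \<open>k\<close> grow excludes every larger constant.
\<close>

section \<open>Calculus of continuously differentiable functions\<close>

lemma Ck_on_cong:
  assumes "open S" "\<And>x. x \<in> S \<Longrightarrow> f x = g x"
  shows "Ck_on k S f \<longleftrightarrow> Ck_on k S g"
  using assms
proof (induction k arbitrary: f g)
  case 0
  then show ?case by (simp cong: continuous_on_cong)
next
  case (Suc k)
  have d: "(f has_derivative D) (at x) \<longleftrightarrow> (g has_derivative D) (at x)" if "x \<in> S" for x D
    using Suc.prems that
    by (metis has_derivative_transform_within_open)
  have "frechet_derivative f (at x) = frechet_derivative g (at x)" if "x \<in> S" for x
    unfolding frechet_derivative_def using d[OF that] by simp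
  moreover have "f differentiable (at x) \<longleftrightarrow> g differentiable (at x)" if "x \<in> S" for x
    unfolding differentiable_def using d[OF that] by simp
  ultimately show ?case
    using Suc.IH[OF Suc.prems(1), of "\<lambda>x. frechet_derivative f (at x) _" "\<lambda>x. frechet_derivative g (at x) _"]
    by simp
qed

text \<open>
  The inductive step of all smoothness proofs below: it suffices to exhibit some derivative whose directional
  values are \<open>C\<^sup>k\<close>, instead of computing with the derivative chosen by \<open>frechet_derivative\<close>.
\<close>

lemma Ck_on_SucI:
  assumes "open S"
    and d: "\<And>x. x \<in> S \<Longrightarrow> (f has_derivative f' x) (at x)"
    and "\<And>v. Ck_on k S (\<lambda>x. f' x v)"
  shows "Ck_on (Suc k) S f"
proof -
  have "Ck_on k S (\<lambda>x. frechet_derivative f (at x) v) \<longleftrightarrow> Ck_on k S (\<lambda>x. f' x v)" for v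
    using frechet_derivative_at[OF d] by (intro Ck_on_cong[OF \<open>open S\<close>]) simp
  then show ?thesis
    using assms by (auto simp: differentiable_def)
qed

lemma Ck_on_Suc_has_derivative:
  assumes "Ck_on (Suc k) S f" "x \<in> S"
  shows "(f has_derivative frechet_derivative f (at x)) (at x)"
  using assms by (simp add: frechet_derivative_works)

lemma Ck_on_SucD: "Ck_on (Suc k) S f \<Longrightarrow> Ck_on k S f"
proof (induction k arbitrary: f)
  case 0
  then show ?case
    by (auto intro!: continuous_at_imp_continuous_on differentiable_imp_continuous_within)
next
  case (Suc k)
  from Suc.prems have "\<forall>v. Ck_on (Suc k) S (\<lambda>x. frechet_derivative f (at x) v)"
    unfolding Ck_on.simps(2)[of "Suc k"] by blast
  then have "\<forall>v. Ck_on k S (\<lambda>x. frechet_derivative f (at x) v)"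
    using Suc.IH by blast
  with Suc.prems show ?case
    by simp
qed

lemma Ck_on_imp_continuous_on: "Ck_on k S f \<Longrightarrow> continuous_on S f"
proof (induction k)
  case (Suc k)
  then show ?case using Ck_on_SucD[of k S f] by simp
qed simp

lemma Ck_on_subset: "Ck_on k S f \<Longrightarrow> T \<subseteq> S \<Longrightarrow> Ck_on k T f"
  by (induction k arbitrary: f) (auto intro: continuous_on_subset)

lemma Ck_on_const: "Ck_on k S (\<lambda>x. c)"
  by (induction k arbitrary: c) auto

lemma Ck_on_bounded_linear:
  assumes "open S" "bounded_linear f"
  shows "Ck_on k S f"
proof (cases k)
  case 0
  then show ?thesis
    using assms by (simp add: linear_continuous_on)
next
  case (Suc m)
  show ?thesis
    unfolding Suc
    by (rule Ck_on_SucI[OF \<open>open S\<close>, where f' = "\<lambda>_. f"])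
       (auto intro: bounded_linear_imp_has_derivative assms Ck_on_const)
qed

lemma Ck_on_add:
  assumes "open S" "Ck_on k S f" "Ck_on k S g"
  shows "Ck_on k S (\<lambda>x. f x + g x)"
  using assms(2,3)
proof (induction k arbitrary: f g)
  case 0
  then show ?case by (simp add: continuous_on_add)
next
  case (Suc k)
  show ?case
    by (rule Ck_on_SucI[OF \<open>open S\<close>])
       (use Suc in \<open>auto intro!: has_derivative_add[OF Ck_on_Suc_has_derivative Ck_on_Suc_has_derivative]\<close>)
qed

lemma Ck_on_mult:
  assumes "open S" "Ck_on k S f" "Ck_on k S g"
  shows "Ck_on k S (\<lambda>x. f x * g x)"
  using assms(2,3)
proof (induction k arbitrary: f g)
  case 0
  then show ?case by (simp add: continuous_on_mult)
next
  case (Suc k)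
  note low = Ck_on_SucD[OF Suc.prems(1)] Ck_on_SucD[OF Suc.prems(2)]
  show ?case
    by (rule Ck_on_SucI[OF \<open>open S\<close>, where f' = "\<lambda>x v. f x * frechet_derivative g (at x) v
          + frechet_derivative f (at x) v * g x"])
       (use Suc low in \<open>auto intro!: has_derivative_mult[OF Ck_on_Suc_has_derivative Ck_on_Suc_has_derivative]
          Ck_on_add[OF \<open>open S\<close>]\<close>)
qed

text \<open>
  Since \<open>h\<close> has a real argument, its derivative at \<open>f x\<close> is multiplication by a single \<open>C\<^sup>k\<close> function of
  \<open>f x\<close>; this lets the induction on \<open>k\<close> apply to \<open>h'\<close> and reduces the chain rule to the product rule.
\<close>

lemma Ck_on_compose:
  fixes h :: "real \<Rightarrow> real"
  assumes "open S" "open T" "Ck_on k T h" "Ck_on k S f" "f ` S \<subseteq> T"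
  shows "Ck_on k S (\<lambda>x. h (f x))"
  using assms(3,4)
proof (induction k arbitrary: h)
  case 0
  then show ?case using assms by (auto intro: continuous_on_compose2)
next
  case (Suc k)
  note f = Ck_on_Suc_has_derivative[OF Suc.prems(2)]
  note h = Ck_on_Suc_has_derivative[OF Suc.prems(1)]
  have fT: "f x \<in> T" if "x \<in> S" for x
    using that assms by auto
  have hf: "frechet_derivative h (at (f x)) v = v * frechet_derivative h (at (f x)) 1"
    if "x \<in> S" for x v
    using linear_scale[OF has_derivative_linear[OF h[OF fT[OF that]]], of v 1] by simp
  show ?case
  proof (rule Ck_on_SucI[OF \<open>open S\<close>])
    fix x assume x: "x \<in> S"
    have "((\<lambda>x. h (f x)) has_derivative
        (\<lambda>v. frechet_derivative h (at (f x)) (frechet_derivative f (at x) v))) (at x)"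
      by (rule has_derivative_compose[OF f h]) (use x fT in auto)
    moreover have "(\<lambda>v. frechet_derivative h (at (f x)) (frechet_derivative f (at x) v))
        = (\<lambda>v. frechet_derivative f (at x) v * frechet_derivative h (at (f x)) 1)"
      by (rule ext) (rule hf[OF x])
    ultimately show "((\<lambda>x. h (f x)) has_derivative
        (\<lambda>v. frechet_derivative f (at x) v * frechet_derivative h (at (f x)) 1)) (at x)"
      by (simp only:)
  next
    fix v
    show "Ck_on k S (\<lambda>x. frechet_derivative f (at x) v * frechet_derivative h (at (f x)) 1)"
      using Suc.IH[of "\<lambda>y. frechet_derivative h (at y) 1"] Suc.prems Ck_on_SucD[OF Suc.prems(2)]
      by (intro Ck_on_mult[OF \<open>open S\<close>]) auto
  qed
qed

lemma Ck_on_Suc_real: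
  fixes h :: "real \<Rightarrow> real"
  assumes "open S" "\<And>x. x \<in> S \<Longrightarrow> (h has_real_derivative h' x) (at x)" "Ck_on k S h'"
  shows "Ck_on (Suc k) S h"
  by (rule Ck_on_SucI[OF \<open>open S\<close>, where f' = "\<lambda>x v. h' x * v"])
     (use assms in \<open>auto simp: has_field_derivative_def intro!: Ck_on_mult Ck_on_const\<close>)

lemma Ck_on_exp: "Ck_on k UNIV (exp :: real \<Rightarrow> real)"
proof (induction k)
  case 0
  show ?case by (simp add: continuous_on_exp)
next
  case (Suc k)
  then show ?case
    by (intro Ck_on_Suc_real[where h' = exp]) auto
qed

lemma Ck_on_inverse: "Ck_on k {0<..} (inverse :: real \<Rightarrow> real)"
proof (induction k)
  case 0
  show ?case by (auto intro!: continuous_intros)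
next
  case (Suc k)
  show ?case
  proof (rule Ck_on_Suc_real[where h' = "\<lambda>x. (- 1) * (inverse x * inverse x)"])
    show "Ck_on k {0<..} (\<lambda>x::real. (- 1) * (inverse x * inverse x))"
      by (intro Ck_on_mult Ck_on_const Suc) auto
  qed (auto intro!: derivative_eq_intros)
qed

lemma Ck_on_ln: "Ck_on k {0<..} (ln :: real \<Rightarrow> real)"
proof (cases k)
  case 0
  then show ?thesis by (auto intro!: continuous_intros)
next
  case (Suc m)
  show ?thesis
    unfolding Suc
    by (rule Ck_on_Suc_real[where h' = inverse])
       (auto intro!: DERIV_ln Ck_on_inverse)
qed

lemma Ck_on_powr: "Ck_on k {0<..} (\<lambda>x::real. x powr a)"
proof -
  have "Ck_on k {0<..} (\<lambda>x::real. exp (a * ln x))"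
    by (rule Ck_on_compose[OF _ open_UNIV Ck_on_exp])
       (auto intro!: Ck_on_mult Ck_on_const Ck_on_ln)
  then show ?thesis
    by (subst Ck_on_cong[where g = "\<lambda>x::real. exp (a * ln x)"]) (auto simp: powr_def)
qed

lemma frechet_derivative_eq_0_open:
  assumes "open S" "x \<in> S" "\<And>y. y \<in> S \<Longrightarrow> f y = (0::real)"
  shows "frechet_derivative f (at x) = (\<lambda>v. 0)" "f differentiable (at x)"
proof -
  have *: "(f has_derivative (\<lambda>v. 0)) (at x)"
    by (rule has_derivative_transform_within_open[OF has_derivative_const[of 0] assms(1,2)])
       (simp add: assms(3))
  show "frechet_derivative f (at x) = (\<lambda>v. 0)"
    using frechet_derivative_at[OF *] by simp
  show "f differentiable (at x)"
    using * unfolding differentiable_def by blast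
qed

lemma frechet_derivative_eq_0_outside:
  assumes "closed K" "\<And>y. y \<notin> K \<Longrightarrow> f y = (0::real)" "x \<notin> K"
  shows "frechet_derivative f (at x) v = 0"
  using frechet_derivative_eq_0_open(1)[of "- K" x f] assms by (simp add: open_Compl)

text \<open>
  The open sets \<open>U\<close> and \<open>- K\<close> cover the space and \<open>f\<close> vanishes on the second one. This removes the singularity
  at the origin: weights that are smooth only away from it become globally \<open>C\<^sup>1\<close> once multiplied by a test function.
\<close>

lemma Ck_on_extend:
  assumes "open U" "closed K" "K \<subseteq> U" "Ck_on k U f" "\<And>x. x \<notin> K \<Longrightarrow> f x = 0"
  shows "Ck_on k UNIV f"
  using assms(4,5)
proof (induction k arbitrary: f)
  case 0
  have "continuous_on (- K) f"
    by (rule continuous_on_eq[OF continuous_on_const[of _ 0]]) (simp add: 0(2))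
  then have "continuous_on (U \<union> - K) f"
    using 0(1) \<open>open U\<close> \<open>closed K\<close> by (intro continuous_on_open_Un) (simp_all add: open_Compl)
  moreover have "U \<union> - K = UNIV" using \<open>K \<subseteq> U\<close> by blast
  ultimately show ?case by simp
next
  case (Suc k)
  have "f differentiable (at x)" for x
  proof (cases "x \<in> U")
    case True
    then show ?thesis using Suc.prems(1) by simp
  next
    case False
    then show ?thesis
      using \<open>closed K\<close> \<open>K \<subseteq> U\<close> Suc.prems(2)
      by (intro frechet_derivative_eq_0_open(2)[of "- K" x f]) (auto simp: open_Compl)
  qed
  moreover have "Ck_on k UNIV (\<lambda>x. frechet_derivative f (at x) v)" for v
  proof (rule Suc.IH)
    show "Ck_on k U (\<lambda>x. frechet_derivative f (at x) v)"
      using Suc.prems(1) by simp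
  qed (rule frechet_derivative_eq_0_outside[OF \<open>closed K\<close> Suc.prems(2)])
  ultimately show ?case by simp
qed

section \<open>The divergence theorem for linear vector fields\<close>

lemma integrable_continuous_compact_support:
  fixes f :: "'a::euclidean_space \<Rightarrow> real"
  assumes "compact K" "continuous_on K f" "\<And>x. x \<notin> K \<Longrightarrow> f x = 0"
  shows "integrable lborel f"
proof -
  have "(\<lambda>x. indicator K x *\<^sub>R f x) = f"
    using assms(3) by (force simp: indicator_def)
  with borel_integrable_compact[OF assms(1,2)] show ?thesis by metis
qed

text \<open>
  Translation invariance makes the integral of each difference quotient vanish. The quotients are bounded by a
  bound for the derivative on one fixed ball, so dominated convergence carries this to the derivative.
\<close>

lemma integral_directional_derivative_eq_0:
  fixes F :: "'a::euclidean_space \<Rightarrow> real"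
  assumes F: "Ck_on 1 UNIV F" and K: "compact K" and F0: "\<And>x. x \<notin> K \<Longrightarrow> F x = 0"
  shows "(\<integral>x. frechet_derivative F (at x) v \<partial>lborel) = 0"
proof -
  define D where "D x = frechet_derivative F (at x) v" for x
  have F': "(F has_derivative frechet_derivative F (at x)) (at x)" for x
    using Ck_on_Suc_has_derivative[of 0 UNIV F x] F by simp
  have contD: "continuous_on UNIV D"
    using F by (simp add: D_def[abs_def])
  have contF: "continuous_on UNIV F"
    by (rule Ck_on_imp_continuous_on[OF F])
  have D0: "D x = 0" if "x \<notin> K" for x
    using frechet_derivative_eq_0_outside[of K F x v] K F0 that
    by (simp add: D_def compact_imp_closed)
  obtain M0 where M0: "\<And>x. x \<in> K \<Longrightarrow> norm (D x) \<le> M0"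
    using compact_imp_bounded[OF compact_continuous_image[OF continuous_on_subset[OF contD] K]]
    unfolding bounded_iff by auto
  define M where "M = max M0 0"
  have M: "\<bar>D x\<bar> \<le> M" for x
    using M0[of x] D0[of x] by (cases "x \<in> K") (auto simp: M_def)
  obtain R where R: "\<And>x. x \<in> K \<Longrightarrow> norm x \<le> R"
    using compact_imp_bounded[OF K] unfolding bounded_iff by auto
  have line: "((\<lambda>s. F (x + s *\<^sub>R v)) has_real_derivative D (x + s *\<^sub>R v)) (at s)" for x s
  proof -
    have "((\<lambda>s. F (x + s *\<^sub>R v)) has_derivative
       (\<lambda>r. frechet_derivative F (at (x + s *\<^sub>R v)) (r *\<^sub>R v))) (at s)"
      by (rule has_derivative_compose[OF _ F']) (auto intro!: derivative_eq_intros)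
    moreover have "(\<lambda>r. frechet_derivative F (at (x + s *\<^sub>R v)) (r *\<^sub>R v)) = (*) (D (x + s *\<^sub>R v))"
      using linear_scale[OF has_derivative_linear[OF F']] by (auto simp: D_def fun_eq_iff)
    ultimately show ?thesis by (simp add: has_field_derivative_def)
  qed
  define h where "h n = inverse (real (Suc n))" for n
  have h: "0 < h n" "h n \<le> 1" for n
    by (auto simp: h_def field_simps)
  define g where "g n x = (F (x + h n *\<^sub>R v) - F x) / h n" for n x
  have intF: "integrable lborel F"
    by (rule integrable_continuous_compact_support[OF K continuous_on_subset[OF contF] F0]) auto
  have mF: "F \<in> borel_measurable borel"
    using contF by (rule borel_measurable_continuous_onI)
  have trans: "integrable lborel (\<lambda>x. F (x + c))" "(\<integral>x. F (x + c) \<partial>lborel) = (\<integral>x. F x \<partial>lborel)" for c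
  proof -
    have d: "lborel = distr lborel borel ((+) c)"
      by (simp add: lborel_distr_plus)
    have "integrable (distr lborel borel ((+) c)) F"
      using intF d by simp
    then show "integrable lborel (\<lambda>x. F (x + c))"
      by (subst (asm) integrable_distr_eq) (auto simp: mF add.commute)
    have "(\<integral>x. F x \<partial>lborel) = (\<integral>x. F x \<partial>distr lborel borel ((+) c))"
      using d by simp
    also have "\<dots> = (\<integral>x. F (c + x) \<partial>lborel)"
      by (rule integral_distr) (auto simp: mF)
    finally show "(\<integral>x. F (x + c) \<partial>lborel) = (\<integral>x. F x \<partial>lborel)"
      by (simp add: add.commute)
  qed
  have int_g: "(\<integral>x. g n x \<partial>lborel) = 0" for n
    unfolding g_def using trans intF by simp
  have lim: "(\<lambda>n. g n x) \<longlonglongrightarrow> D x" for x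
  proof -
    have "((\<lambda>s. (F (x + s *\<^sub>R v) - F x) / s) \<longlongrightarrow> D x) (at 0)"
      using line[of x 0] by (simp add: DERIV_def)
    moreover have "filterlim h (at 0) sequentially"
      using LIMSEQ_inverse_real_of_nat h(1) unfolding h_def[abs_def]
      by (auto simp: filterlim_at intro!: always_eventually)
    ultimately show ?thesis
      unfolding g_def by (rule filterlim_compose)
  qed
  have bound: "norm (g n x) \<le> M * indicator (cball 0 (R + norm v)) x" for n x
  proof (cases "x \<in> cball 0 (R + norm v)")
    case True
    obtain z where z: "0 < z" "z < h n"
        "F (x + h n *\<^sub>R v) - F (x + 0 *\<^sub>R v) = (h n - 0) * D (x + z *\<^sub>R v)"
      using MVT2[OF h(1)[of n] line[of x]] by blast
    then have "g n x = D (x + z *\<^sub>R v)"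
      using h(1)[of n] by (simp add: g_def)
    with True M show ?thesis by simp
  next
    case False
    then have x: "norm x > R + norm v" by simp
    have "norm (h n *\<^sub>R v) \<le> norm v"
      using h[of n] mult_right_mono[of "h n" 1 "norm v"] by simp
    then have "norm (x + h n *\<^sub>R v) > R"
      using x norm_triangle_ineq4[of "x + h n *\<^sub>R v" "h n *\<^sub>R v"] by simp
    moreover have "norm x > R"
      using x norm_ge_zero[of v] by linarith
    ultimately have "x + h n *\<^sub>R v \<notin> K" "x \<notin> K"
      using R by fastforce+
    then show ?thesis using False F0 by (simp add: g_def)
  qed
  have "(\<lambda>n. \<integral>x. g n x \<partial>lborel) \<longlonglongrightarrow> (\<integral>x. D x \<partial>lborel)"
  proof (rule integral_dominated_convergence[where w = "\<lambda>x. M * indicator (cball 0 (R + norm v)) x"])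
    show "D \<in> borel_measurable lborel"
      using borel_measurable_continuous_onI[OF contD] by simp
    show "g n \<in> borel_measurable lborel" for n
      unfolding g_def[abs_def] using trans(1)[of "h n *\<^sub>R v"] mF by (simp add: borel_measurable_integrable)
    show "integrable lborel (\<lambda>x::'a. M * indicator (cball 0 (R + norm v)) x)"
      using emeasure_compact_finite[OF compact_cball, of "0::'a" "R + norm v"]
      by (intro integrable_mult_right integrable_real_indicator) simp_all
  qed (use lim bound in auto)
  then have "(\<integral>x. D x \<partial>lborel) = 0"
    by (simp add: int_g LIMSEQ_const_iff)
  then show ?thesis by (simp add: D_def[abs_def])
qed

text \<open>
  Integration by parts in each basis direction, applied to the product of \<open>F\<close> with a
  component of \<open>A x\<close>; the diagonal entries of \<open>A\<close> appear as derivatives of these components.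
\<close>

lemma integral_linear_field_derivative:
  fixes F :: "'a::euclidean_space \<Rightarrow> real"
  assumes F: "Ck_on 1 UNIV F" and K: "compact K" and F0: "\<And>x. x \<notin> K \<Longrightarrow> F x = 0"
    and A: "linear A"
  shows "integrable lborel (\<lambda>x. frechet_derivative F (at x) (A x))" (is ?int)
    and "(\<integral>x. frechet_derivative F (at x) (A x) \<partial>lborel)
       = - (\<Sum>b\<in>Basis. A b \<bullet> b) * (\<integral>x. F x \<partial>lborel)" (is ?eq)
proof -
  have F': "(F has_derivative frechet_derivative F (at x)) (at x)" for x
    using Ck_on_Suc_has_derivative[of 0 UNIV F x] F by simp
  have contF: "continuous_on UNIV F"
    by (rule Ck_on_imp_continuous_on[OF F])
  have contD: "continuous_on UNIV (\<lambda>x. frechet_derivative F (at x) v)" for v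
    using F by simp
  have blA: "bounded_linear (\<lambda>x. A x \<bullet> b)" for b
    using A by (intro bounded_linear_compose[OF bounded_linear_inner_left] linear_conv_bounded_linear[THEN iffD1])
  have D0: "frechet_derivative F (at x) v = 0" if "x \<notin> K" for x v
    using frechet_derivative_eq_0_outside[of K F x v] K F0 that
    by (simp add: compact_imp_closed)
  have intF: "integrable lborel F"
    by (rule integrable_continuous_compact_support[OF K continuous_on_subset[OF contF] F0]) auto
  have intb: "integrable lborel (\<lambda>x. (A x \<bullet> b) * frechet_derivative F (at x) b)" for b
    by (rule integrable_continuous_compact_support[OF K])
       (use D0 in \<open>auto intro!: continuous_on_mult continuous_on_subset[OF contD]
         linear_continuous_on[OF blA]\<close>)
  have expand: "frechet_derivative F (at x) (A x) = (\<Sum>b\<in>Basis. (A x \<bullet> b) * frechet_derivative F (at x) b)" for x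
  proof -
    have lin: "linear (frechet_derivative F (at x))"
      by (rule has_derivative_linear[OF F'])
    have "frechet_derivative F (at x) (A x) = frechet_derivative F (at x) (\<Sum>b\<in>Basis. (A x \<bullet> b) *\<^sub>R b)"
      by (simp add: euclidean_representation)
    also have "\<dots> = (\<Sum>b\<in>Basis. (A x \<bullet> b) * frechet_derivative F (at x) b)"
      by (simp add: linear_sum[OF lin] linear_scale[OF lin])
    finally show ?thesis .
  qed
  show ?int
    unfolding expand by (intro Bochner_Integration.integrable_sum intb)
  have parts: "(\<integral>x. (A x \<bullet> b) * frechet_derivative F (at x) b \<partial>lborel) = - (A b \<bullet> b) * (\<integral>x. F x \<partial>lborel)" for b
  proof -
    let ?G = "\<lambda>x. (A x \<bullet> b) * F x"
    have "Ck_on 1 UNIV ?G"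
      by (intro Ck_on_mult F Ck_on_bounded_linear blA open_UNIV)
    then have "(\<integral>x. frechet_derivative ?G (at x) b \<partial>lborel) = 0"
      by (rule integral_directional_derivative_eq_0[OF _ K]) (simp add: F0)
    moreover have "frechet_derivative ?G (at x) b = (A x \<bullet> b) * frechet_derivative F (at x) b + (A b \<bullet> b) * F x" for x
      using fun_cong[OF frechet_derivative_at[OF has_derivative_mult[OF
          bounded_linear_imp_has_derivative[OF blA[of b]] F']], of x b]
      by simp
    ultimately have "(\<integral>x. (A x \<bullet> b) * frechet_derivative F (at x) b + (A b \<bullet> b) * F x \<partial>lborel) = 0"
      by simp
    then show ?thesis
      using intb[of b] intF by simp
  qed
  show ?eq
    unfolding expand
    by (subst Bochner_Integration.integral_sum) (simp_all add: intb parts sum_negf sum_distrib_right)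
qed

section \<open>Horizontal gradient of the gauge\<close>

text \<open>
  The fourth power of the Heisenberg norm. Unlike the norm itself it is a polynomial, hence smooth.
\<close>

definition gauge4 :: "'n::finite heis \<Rightarrow> real" where
  "gauge4 p = norm (fst p) ^ 4 + (snd p)\<^sup>2"

text \<open>
  The generator of the one-parameter group \<open>(z, t) \<mapsto> (l z, l\<^sup>2 t)\<close> at \<open>l = 1\<close>.
\<close>

definition dilation_field :: "'n::finite heis \<Rightarrow> 'n heis" where
  "dilation_field p = (fst p, 2 * snd p)"

text \<open>
  The generator of \<open>(z, t) \<mapsto> (exp (- i \<theta>) z, t)\<close> at \<open>\<theta> = 0\<close>; these rotations preserve the Heisenberg norm.
\<close>

definition rotation_field :: "'n::finite heis \<Rightarrow> 'n heis" where
  "rotation_field p = ((\<chi> j. - \<i> * fst p $ j), 0)"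

text \<open>
  A quarter of the horizontal gradient of \<open>gauge4\<close>.
\<close>

definition gauge_dir :: "'n::finite heis \<Rightarrow> (real ^ 'n) \<times> (real ^ 'n)" where
  "gauge_dir p =
    ((\<chi> j. (norm (fst p))\<^sup>2 * Re (fst p $ j) + snd p * Im (fst p $ j)),
     (\<chi> j. (norm (fst p))\<^sup>2 * Im (fst p $ j) - snd p * Re (fst p $ j)))"

lemma gauge4_pos: "p \<noteq> 0 \<Longrightarrow> 0 < gauge4 p"
  unfolding gauge4_def
  by (cases "fst p = 0")
     (auto simp: prod_eq_iff intro!: add_pos_nonneg)

lemma heis_norm_powr: "heis_norm p powr a = gauge4 p powr (a / 4)"
  by (simp add: heis_norm_def gauge4_def powr_powr)

lemma heis_norm_power4: "heis_norm p ^ 4 = gauge4 p"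
proof (cases "p = 0")
  case True
  then show ?thesis by (simp add: heis_norm_def gauge4_def)
next
  case False
  have "heis_norm p ^ 4 = heis_norm p powr 4"
    using gauge4_pos[OF False] by (simp add: heis_norm_def gauge4_def flip: powr_numeral)
  then show ?thesis
    using gauge4_pos[OF False] by (simp add: heis_norm_powr)
qed

lemma norm_complex_vec_sq:
  fixes z :: "complex ^ 'n::finite"
  shows "(norm z)\<^sup>2 = (\<Sum>j\<in>UNIV. (Re (z $ j))\<^sup>2 + (Im (z $ j))\<^sup>2)"
  unfolding power2_norm_eq_inner by (simp add: inner_vec_def inner_complex_def power2_eq_square)

lemma linear_heis_expand:
  fixes D :: "'n::finite heis \<Rightarrow> real"
  assumes "linear D"
  shows "D p = (\<Sum>j\<in>UNIV. Re (fst p $ j) * D (axis j 1, 0) + Im (fst p $ j) * D (axis j \<i>, 0))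
     + snd p * D (0, 1)"
proof -
  have ax: "axis j x $ i = (if i = j then x else 0)" for i j :: 'n and x :: complex
    by (simp add: axis_def)
  have "p = (\<Sum>j\<in>UNIV. Re (fst p $ j) *\<^sub>R (axis j 1, 0) + Im (fst p $ j) *\<^sub>R (axis j \<i>, 0))
      + snd p *\<^sub>R (0, 1)"
    by (auto simp: prod_eq_iff vec_eq_iff complex_eq_iff fst_sum snd_sum sum_component sum.distrib ax
        if_distrib if_distribR cong: if_cong)
  then have "D p = D ((\<Sum>j\<in>UNIV. Re (fst p $ j) *\<^sub>R (axis j 1, 0) + Im (fst p $ j) *\<^sub>R (axis j \<i>, 0))
      + snd p *\<^sub>R (0, 1))"
    by simp
  then show ?thesis
    by (simp only: linear_add[OF assms] linear_sum[OF assms] linear_scale[OF assms] real_scaleR_def)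
qed

lemma inner_heis_grad:
  "heis_grad f p \<bullet> ((\<chi> j. a j), (\<chi> j. b j)) = (\<Sum>j\<in>UNIV. heis_X j f p * a j + heis_Y j f p * b j)"
  by (simp add: heis_grad_def inner_vec_def sum.distrib)

text \<open>
  The key identity: differentiating along the horizontal gradient of the gauge amounts to
  differentiating along a combination of two linear fields. The \<open>t\<close>-derivatives from the fields \<open>X\<^sub>j\<close>, \<open>Y\<^sub>j\<close>
  add up to the \<open>t\<close>-component of the dilation field because \<open>x\<^sub>j\<^sup>2 + y\<^sub>j\<^sup>2\<close> sums to \<open>|z|\<^sup>2\<close>.
\<close>

lemma heis_grad_inner_gauge_dir:
  fixes f :: "'n::finite heis \<Rightarrow> real"
  assumes "f differentiable (at p)"
  shows "heis_grad f p \<bullet> gauge_dir p =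
     (norm (fst p))\<^sup>2 * frechet_derivative f (at p) (dilation_field p)
     + snd p * frechet_derivative f (at p) (rotation_field p)"
proof -
  let ?D = "frechet_derivative f (at p)"
  have lin: "linear ?D"
    using assms by (simp add: linear_frechet_derivative)
  define x y dx dy where "x j = Re (fst p $ j)" and "y j = Im (fst p $ j)"
    and "dx j = ?D (axis j 1, 0)" and "dy j = ?D (axis j \<i>, 0)" for j
  define t dt s where "t = snd p" and "dt = ?D (0, 1)" and "s = (norm (fst p))\<^sup>2"
  have s: "s = (\<Sum>j\<in>UNIV. (x j)\<^sup>2 + (y j)\<^sup>2)"
    by (simp add: s_def x_def y_def norm_complex_vec_sq)
  have E: "?D (dilation_field p) = (\<Sum>j\<in>UNIV. x j * dx j + y j * dy j) + 2 * t * dt"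
    by (subst linear_heis_expand[OF lin]) (simp add: dilation_field_def x_def y_def dx_def dy_def t_def dt_def)
  have R: "?D (rotation_field p) = (\<Sum>j\<in>UNIV. y j * dx j - x j * dy j)"
    by (subst linear_heis_expand[OF lin]) (simp add: rotation_field_def x_def y_def dx_def dy_def t_def dt_def)
  have "heis_grad f p \<bullet> gauge_dir p
     = (\<Sum>j\<in>UNIV. (dx j + 2 * y j * dt) * (s * x j + t * y j) + (dy j - 2 * x j * dt) * (s * y j - t * x j))"
    unfolding gauge_dir_def inner_heis_grad
    by (simp add: heis_X_def heis_Y_def partial_x_def partial_y_def partial_t_def x_def y_def dx_def dy_def t_def dt_def s_def)
  also have "\<dots> = (\<Sum>j\<in>UNIV. s * (x j * dx j + y j * dy j) + t * (y j * dx j - x j * dy j)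
       + 2 * t * dt * ((x j)\<^sup>2 + (y j)\<^sup>2))"
    by (intro sum.cong) (auto simp: algebra_simps power2_eq_square)
  also have "\<dots> = s * (\<Sum>j\<in>UNIV. x j * dx j + y j * dy j) + t * (\<Sum>j\<in>UNIV. y j * dx j - x j * dy j) + 2 * t * dt * s"
    by (simp only: sum.distrib[where h = "\<lambda>j. 2 * t * dt * ((x j)\<^sup>2 + (y j)\<^sup>2)"]
        sum.distrib[where h = "\<lambda>j. t * (y j * dx j - x j * dy j)"]
        sum_distrib_left[symmetric] s[symmetric])
  also have "\<dots> = s * ?D (dilation_field p) + t * ?D (rotation_field p)"
    unfolding E R by (simp add: algebra_simps)
  finally show ?thesis by (simp add: s_def t_def)
qed

text \<open>
  In each coordinate plane, \<open>gauge_dir\<close> is \<open>z\<^sub>j\<close> scaled by \<open>|z|\<^sup>2\<close> plus \<open>z\<^sub>j\<close> turned by a right angle and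
  scaled by \<open>t\<close>; the two parts are orthogonal.
\<close>

lemma norm_gauge_dir: "(norm (gauge_dir p))\<^sup>2 = (norm (fst p))\<^sup>2 * gauge4 p"
proof -
  define x y where "x j = Re (fst p $ j)" and "y j = Im (fst p $ j)" for j
  define t s where "t = snd p" and "s = (norm (fst p))\<^sup>2"
  have s: "s = (\<Sum>j\<in>UNIV. (x j)\<^sup>2 + (y j)\<^sup>2)"
    by (simp add: s_def x_def y_def norm_complex_vec_sq)
  have "(norm (gauge_dir p))\<^sup>2 = (\<Sum>j\<in>UNIV. (s * x j + t * y j)\<^sup>2 + (s * y j - t * x j)\<^sup>2)"
    unfolding power2_norm_eq_inner
    by (simp add: gauge_dir_def inner_vec_def inner_prod_def sum.distrib
        x_def y_def t_def s_def flip: power2_eq_square)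
  also have "\<dots> = (\<Sum>j\<in>UNIV. (s\<^sup>2 + t\<^sup>2) * ((x j)\<^sup>2 + (y j)\<^sup>2))"
    by (intro sum.cong) (auto simp: algebra_simps power2_eq_square)
  also have "\<dots> = (s\<^sup>2 + t\<^sup>2) * s"
    unfolding s by (simp only: sum_distrib_left)
  finally show ?thesis
    by (simp add: gauge4_def s_def t_def algebra_simps flip: power_mult)
qed

lemma gauge4_has_derivative:
  "(gauge4 has_derivative (\<lambda>v. 4 * (norm (fst p))\<^sup>2 * (fst p \<bullet> fst v) + 2 * snd p * snd v)) (at p)"
proof -
  have eq: "gauge4 = (\<lambda>p. (fst p \<bullet> fst p)\<^sup>2 + (snd p)\<^sup>2)"
    by (simp add: fun_eq_iff gauge4_def flip: power2_norm_eq_inner power_mult)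
  show ?thesis
    unfolding eq power2_norm_eq_inner
    by (auto intro!: derivative_eq_intros simp: fun_eq_iff inner_commute algebra_simps)
qed

lemma norm_fst_sq_has_derivative:
  "((\<lambda>p::'n::finite heis. (norm (fst p))\<^sup>2) has_derivative (\<lambda>v. 2 * (fst p \<bullet> fst v))) (at p)"
  unfolding power2_norm_eq_inner
  by (auto intro!: derivative_eq_intros simp: fun_eq_iff inner_commute algebra_simps)

lemma Ck_on_norm_fst: "Ck_on k UNIV (\<lambda>p::'n::finite heis. (norm (fst p))\<^sup>2)"
proof (cases k)
  case 0
  then show ?thesis by (auto intro!: continuous_intros)
next
  case (Suc m)
  show ?thesis
    unfolding Suc
  proof (rule Ck_on_SucI)
    show "((\<lambda>p::'n heis. (norm (fst p))\<^sup>2) has_derivative (\<lambda>v. 2 * (fst p \<bullet> fst v))) (at p)" for p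
      by (rule norm_fst_sq_has_derivative)
    show "Ck_on m UNIV (\<lambda>p::'n heis. 2 * (fst p \<bullet> fst v))" for v :: "'n heis"
      by (intro Ck_on_mult Ck_on_const open_UNIV Ck_on_bounded_linear
          bounded_linear_compose[OF bounded_linear_inner_left bounded_linear_fst])
  qed auto
qed

lemma Ck_on_snd: "Ck_on k UNIV (snd :: 'n::finite heis \<Rightarrow> real)"
  by (intro Ck_on_bounded_linear bounded_linear_snd open_UNIV)

lemma Ck_on_gauge4: "Ck_on k UNIV (gauge4 :: 'n::finite heis \<Rightarrow> real)"
proof -
  have eq: "gauge4 = (\<lambda>p::'n heis. (norm (fst p))\<^sup>2 * (norm (fst p))\<^sup>2 + snd p * snd p)"
    by (simp add: gauge4_def fun_eq_iff power2_eq_square power4_eq_xxxx)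
  show ?thesis
    unfolding eq by (intro Ck_on_add Ck_on_mult Ck_on_norm_fst Ck_on_snd open_UNIV)
qed

lemma gauge4_image: "gauge4 ` (- {0}) \<subseteq> {0<..}"
  unfolding image_subset_iff using gauge4_pos by blast

lemma Ck_on_gauge4_powr: "Ck_on k (- {0}) (\<lambda>p::'n::finite heis. gauge4 p powr a)"
  by (rule Ck_on_compose[OF _ _ Ck_on_powr Ck_on_subset[OF Ck_on_gauge4] gauge4_image]) auto

lemma gauge4_powr_has_derivative:
  assumes "p \<noteq> 0"
  shows "((\<lambda>p. gauge4 p powr a) has_derivative
     (\<lambda>v. (4 * (norm (fst p))\<^sup>2 * (fst p \<bullet> fst v) + 2 * snd p * snd v) * (a * gauge4 p powr (a - 1)))) (at p)"
  by (rule DERIV_compose_FDERIV[OF has_real_derivative_powr[OF gauge4_pos[OF assms]] gauge4_has_derivative])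

lemma rotation_field_orthogonal: "fst p \<bullet> fst (rotation_field p) = 0"
  by (simp add: rotation_field_def inner_vec_def inner_complex_def)

lemma linear_dilation_field: "linear dilation_field"
  by (rule linearI) (auto simp: dilation_field_def)

lemma linear_rotation_field: "linear rotation_field"
  by (rule linearI) (auto simp: rotation_field_def vec_eq_iff algebra_simps)

text \<open>
  The trace is the homogeneous dimension \<open>Q\<close>: each of the \<open>2 n\<close> horizontal directions counts once and \<open>t\<close> twice.
\<close>

lemma trace_dilation_field:
  "(\<Sum>b\<in>Basis. dilation_field b \<bullet> (b::'n::finite heis)) = 2 * real CARD('n) + 2"
proof -
  have "(\<Sum>b\<in>Basis. dilation_field b \<bullet> (b::'n heis))
    = (\<Sum>b\<in>(\<lambda>u. (u, 0)) ` (Basis :: (complex^'n) set). dilation_field b \<bullet> b)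
     + (\<Sum>b\<in>(\<lambda>v. (0, v)) ` (Basis :: real set). dilation_field b \<bullet> (b::'n heis))"
    unfolding Basis_prod_def by (intro sum.union_disjoint) auto
  also have "\<dots> = (\<Sum>u\<in>(Basis :: (complex^'n) set). 1) + 2"
    by (subst sum.reindex) (auto simp: inj_on_def dilation_field_def)
  finally show ?thesis by simp
qed

lemma trace_rotation_field:
  "(\<Sum>b\<in>Basis. rotation_field b \<bullet> (b::'n::finite heis)) = 0"
proof -
  have "rotation_field b \<bullet> b = 0" for b :: "'n heis"
    using rotation_field_orthogonal[of b] by (simp add: inner_prod_def inner_commute rotation_field_def)
  then show ?thesis by simp
qed

section \<open>The weighted Hardy inequality\<close>

text \<open>
  Meant for an energy density \<open>g\<close>, whose integral may be infinite.
\<close>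

lemma integral_le_nn_integral:
  assumes "integrable M f" "\<And>x. f x \<le> g x"
  shows "ennreal (integral\<^sup>L M f) \<le> (\<integral>\<^sup>+ x. ennreal (g x) \<partial>M)"
proof -
  have "integral\<^sup>L M f \<le> (\<integral>x. max 0 (f x) \<partial>M)"
    using assms(1) by (intro integral_mono) auto
  then have "ennreal (integral\<^sup>L M f) \<le> ennreal (\<integral>x. max 0 (f x) \<partial>M)"
    by (rule ennreal_leI)
  also have "\<dots> = (\<integral>\<^sup>+ x. ennreal (max 0 (f x)) \<partial>M)"
    using assms(1) by (intro nn_integral_eq_integral[symmetric]) auto
  also have "\<dots> \<le> (\<integral>\<^sup>+ x. ennreal (g x) \<partial>M)"
    using assms(2) by (intro nn_integral_mono) (auto simp: max_def intro: ennreal_leI)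
  finally show ?thesis .
qed

lemma norm_add_scaleR_sq:
  fixes u v :: "'a::real_inner"
  shows "(norm (u + k *\<^sub>R v))\<^sup>2 = (norm u)\<^sup>2 + 2 * k * (u \<bullet> v) + k\<^sup>2 * (norm v)\<^sup>2"
  unfolding power2_norm_eq_inner
  by (simp add: inner_add_left inner_add_right inner_commute power2_eq_square algebra_simps)

text \<open>
  Completing the square with \<open>c \<phi> / N\<close> times \<open>gauge_dir\<close>. The functions whose derivatives along the two
  fields produce the cross term are \<open>F1 = W |z|\<^sup>2 \<phi>\<^sup>2\<close> (the potential density) and \<open>F2 = W t \<phi>\<^sup>2\<close>, with \<open>W\<close> equal to \<open>\<rho>\<close>
  to the power \<open>\<alpha> - 4\<close>.
\<close>

lemma hardy_inequality:
  fixes \<phi> :: "'n::finite heis \<Rightarrow> real" and \<alpha> :: real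
  defines "c \<equiv> (2 * real CARD('n) + \<alpha>) / 2"
  assumes \<phi>: "\<phi> \<in> C0_infinity (- {0})"
  shows "ennreal (c\<^sup>2) * hardy_potential \<alpha> \<phi> \<le> hardy_energy \<alpha> \<phi>"
proof -
  define K where "K = closure {p. \<phi> p \<noteq> 0}"
  have K: "compact K" "K \<subseteq> - {0}" and CU: "Ck_on 1 (- {0}) \<phi>"
    using \<phi> unfolding C0_infinity_def K_def by blast+
  have clK: "closed K" by (simp add: K_def)
  have \<phi>0: "\<phi> p = 0" if "p \<notin> K" for p
    using that closure_subset[of "{p. \<phi> p \<noteq> 0}"] by (auto simp: K_def)
  have zero: "\<phi> 0 = 0"
    using \<phi>0 K(2) by blast
  have C\<phi>: "Ck_on 1 UNIV \<phi>"
    by (rule Ck_on_extend[OF _ clK K(2) CU \<phi>0]) auto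
  let ?D = "\<lambda>p. frechet_derivative \<phi> (at p)"
  have D: "(\<phi> has_derivative ?D p) (at p)" for p
    using Ck_on_Suc_has_derivative[of 0 UNIV \<phi> p] C\<phi> by simp
  define a where "a = \<alpha> / 4 - 1"
  define W where "W p = gauge4 p powr a" for p :: "'n heis"
  define s where "s p = (norm (fst p))\<^sup>2" for p :: "'n heis"
  define F1 where "F1 p = W p * s p * (\<phi> p * \<phi> p)" for p
  define F2 where "F2 p = W p * snd p * (\<phi> p * \<phi> p)" for p
  have F10: "F1 p = 0" and F20: "F2 p = 0" if "p \<notin> K" for p
    using \<phi>0[OF that] by (simp_all add: F1_def F2_def)
  have C1: "Ck_on 1 UNIV F1"
  proof (rule Ck_on_extend[OF _ clK K(2) _ F10])
    show "Ck_on 1 (- {0}) F1"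
      unfolding F1_def[abs_def] W_def s_def
      by (intro Ck_on_mult CU Ck_on_gauge4_powr Ck_on_subset[OF Ck_on_norm_fst]) auto
  qed auto
  have C2: "Ck_on 1 UNIV F2"
  proof (rule Ck_on_extend[OF _ clK K(2) _ F20])
    show "Ck_on 1 (- {0}) F2"
      unfolding F2_def[abs_def] W_def
      by (intro Ck_on_mult CU Ck_on_gauge4_powr Ck_on_subset[OF Ck_on_snd]) auto
  qed auto
  define E1 where "E1 p = frechet_derivative F1 (at p) (dilation_field p)" for p
  define R2 where "R2 p = frechet_derivative F2 (at p) (rotation_field p)" for p
  have E1: "integrable lborel E1"
      "(\<integral>p. E1 p \<partial>lborel) = - (2 * real CARD('n) + 2) * (\<integral>p. F1 p \<partial>lborel)"
    unfolding E1_def[abs_def]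
    using integral_linear_field_derivative[OF C1 K(1) F10 linear_dilation_field, unfolded trace_dilation_field]
    by auto
  have R2: "integrable lborel R2" "(\<integral>p. R2 p \<partial>lborel) = 0"
    unfolding R2_def[abs_def]
    using integral_linear_field_derivative[OF C2 K(1) F20 linear_rotation_field, unfolded trace_rotation_field]
    by auto
  have intF1: "integrable lborel F1"
    by (rule integrable_continuous_compact_support[OF K(1)
          continuous_on_subset[OF Ck_on_imp_continuous_on[OF C1]] F10]) auto
  have E1_eq: "E1 p = (\<alpha> - 2) * F1 p + 2 * W p * s p * \<phi> p * ?D p (dilation_field p)"
    if p: "p \<noteq> 0" for p
  proof -
    note d = has_derivative_mult[OF has_derivative_mult[OF gauge4_powr_has_derivative[OF p, of a]
          norm_fst_sq_has_derivative] has_derivative_mult[OF D D]]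
    \<comment> \<open>Euler: the gauge is homogeneous of degree 4 under dilations.\<close>
    have N: "4 * (norm (fst p))\<^sup>2 * (fst p \<bullet> fst (dilation_field p)) + 2 * snd p * snd (dilation_field p)
        = 4 * gauge4 p"
      by (simp add: dilation_field_def gauge4_def power2_eq_square power4_eq_xxxx
          flip: power2_norm_eq_inner)
    have W': "gauge4 p * gauge4 p powr (a - 1) = W p"
      using gauge4_pos[OF p] by (simp add: W_def powr_diff)
    have "E1 p = W p * s p * (\<phi> p * ?D p (dilation_field p) + ?D p (dilation_field p) * \<phi> p)
        + (W p * (2 * (fst p \<bullet> fst (dilation_field p))) + 4 * gauge4 p * (a * gauge4 p powr (a - 1)) * s p)
          * (\<phi> p * \<phi> p)"
      using fun_cong[OF frechet_derivative_at[OF d], of "dilation_field p"]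
      unfolding E1_def F1_def[abs_def] W_def s_def N by simp
    also have "fst p \<bullet> fst (dilation_field p) = s p"
      by (simp add: dilation_field_def s_def power2_norm_eq_inner)
    also have "4 * gauge4 p * (a * gauge4 p powr (a - 1)) * s p = 4 * a * W p * s p"
      unfolding W'[symmetric] by simp
    finally show ?thesis
      by (simp add: F1_def a_def algebra_simps)
  qed
  have R2_eq: "R2 p = 2 * W p * snd p * \<phi> p * ?D p (rotation_field p)"
    if p: "p \<noteq> 0" for p
  proof -
    note d = has_derivative_mult[OF has_derivative_mult[OF gauge4_powr_has_derivative[OF p, of a]
          bounded_linear_imp_has_derivative[OF bounded_linear_snd]] has_derivative_mult[OF D D]]
    have "snd (rotation_field p) = 0"
      by (simp add: rotation_field_def)
    then show ?thesis
      using fun_cong[OF frechet_derivative_at[OF d], of "rotation_field p"]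
      unfolding R2_def F2_def[abs_def] W_def by (simp add: rotation_field_orthogonal)
  qed
  have pointwise: "- c * E1 p + c * (\<alpha> - 2) * F1 p - c * R2 p - c\<^sup>2 * F1 p
      \<le> heis_norm p powr \<alpha> * (norm (heis_grad \<phi> p))\<^sup>2" for p
  proof (cases "p = 0")
    case True
    \<comment> \<open>Both linear fields vanish at the origin, where the weight takes a default value.\<close>
    note C1[unfolded One_nat_def, THEN Ck_on_Suc_has_derivative, OF UNIV_I, of 0]
      C2[unfolded One_nat_def, THEN Ck_on_Suc_has_derivative, OF UNIV_I, of 0]
    then have "E1 0 = 0" "R2 0 = 0"
      unfolding E1_def R2_def linear_0[OF linear_dilation_field] linear_0[OF linear_rotation_field]
      by (simp_all add: has_derivative_linear linear_0)
    then show ?thesis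
      using True zero by (simp add: F1_def)
  next
    case False
    let ?N = "gauge4 p" and ?g = "heis_grad \<phi> p"
    note N = gauge4_pos[OF False]
    have NW: "heis_norm p powr \<alpha> = ?N * W p"
      using N by (simp add: heis_norm_powr W_def a_def powr_diff)
    have dot: "?g \<bullet> gauge_dir p = s p * ?D p (dilation_field p) + snd p * ?D p (rotation_field p)"
      unfolding s_def by (rule heis_grad_inner_gauge_dir[OF differentiableI[OF D]])
    \<comment> \<open>The square that is completed, weighted by \<open>\<rho>\<^sup>\<alpha> = N W\<close>.\<close>
    have "0 \<le> ?N * W p * (norm (?g + (c * \<phi> p / ?N) *\<^sub>R gauge_dir p))\<^sup>2"
      using N by (simp add: W_def)
    also have "(norm (?g + (c * \<phi> p / ?N) *\<^sub>R gauge_dir p))\<^sup>2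
        = (norm ?g)\<^sup>2 + 2 * (c * \<phi> p / ?N) * (?g \<bullet> gauge_dir p) + (c * \<phi> p / ?N)\<^sup>2 * (norm (gauge_dir p))\<^sup>2"
      by (rule norm_add_scaleR_sq)
    also have "(c * \<phi> p / ?N)\<^sup>2 * (norm (gauge_dir p))\<^sup>2 = c\<^sup>2 * s p * (\<phi> p * \<phi> p) / ?N"
      using N unfolding power_divide norm_gauge_dir by (simp add: s_def power2_eq_square)
    also have "?N * W p * ((norm ?g)\<^sup>2 + 2 * (c * \<phi> p / ?N) * (?g \<bullet> gauge_dir p)
          + c\<^sup>2 * s p * (\<phi> p * \<phi> p) / ?N)
        = ?N * W p * (norm ?g)\<^sup>2 + 2 * c * \<phi> p * W p * (?g \<bullet> gauge_dir p) + c\<^sup>2 * F1 p"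
      using N by (simp add: F1_def field_simps)
    finally have "- (2 * c * \<phi> p * W p * (?g \<bullet> gauge_dir p)) - c\<^sup>2 * F1 p \<le> ?N * W p * (norm ?g)\<^sup>2"
      by linarith
    moreover have "- c * E1 p + c * (\<alpha> - 2) * F1 p - c * R2 p
        = - (2 * c * \<phi> p * W p * (?g \<bullet> gauge_dir p))"
      unfolding E1_eq[OF False] R2_eq[OF False] dot by (simp add: algebra_simps)
    ultimately show ?thesis
      unfolding NW by simp
  qed
  have "(\<integral>p. - c * E1 p + c * (\<alpha> - 2) * F1 p - c * R2 p - c\<^sup>2 * F1 p \<partial>lborel)
      = - c * (\<integral>p. E1 p \<partial>lborel) + c * (\<alpha> - 2) * (\<integral>p. F1 p \<partial>lborel) - c * (\<integral>p. R2 p \<partial>lborel)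
        - c\<^sup>2 * (\<integral>p. F1 p \<partial>lborel)"
    using E1(1) R2(1) intF1 by simp
  also have "\<dots> = c\<^sup>2 * (\<integral>p. F1 p \<partial>lborel)"
    unfolding E1(2) R2(2) by (simp add: c_def power2_eq_square field_simps)
  finally have int_eq: "(\<integral>p. - c * E1 p + c * (\<alpha> - 2) * F1 p - c * R2 p - c\<^sup>2 * F1 p \<partial>lborel)
      = c\<^sup>2 * (\<integral>p. F1 p \<partial>lborel)" .
  have pot: "heis_norm p powr \<alpha> * ((norm (fst p))\<^sup>2 / heis_norm p ^ 4) * (\<phi> p)\<^sup>2 = F1 p" for p
  proof (cases "p = 0")
    case False
    then show ?thesis
      using gauge4_pos[OF False]
      by (simp add: heis_norm_powr heis_norm_power4 F1_def W_def s_def a_def powr_diff power2_eq_square)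
  qed (simp add: zero F1_def)
  have F1_nonneg: "0 \<le> F1 p" for p
    by (simp add: F1_def W_def s_def)
  have "ennreal (c\<^sup>2) * hardy_potential \<alpha> \<phi> = ennreal (c\<^sup>2) * ennreal (\<integral>p. F1 p \<partial>lborel)"
    unfolding hardy_potential_def pot
    using nn_integral_eq_integral[OF intF1] F1_nonneg by simp
  also have "\<dots> = ennreal (\<integral>p. - c * E1 p + c * (\<alpha> - 2) * F1 p - c * R2 p - c\<^sup>2 * F1 p \<partial>lborel)"
    unfolding int_eq by (simp add: ennreal_mult' )
  also have "\<dots> \<le> hardy_energy \<alpha> \<phi>"
    unfolding hardy_energy_def
    by (rule integral_le_nn_integral[OF _ pointwise]) (use E1(1) R2(1) intF1 in simp)
  finally show ?thesis .
qed

section \<open>A smooth step function\<close>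

text \<open>
  Every derivative of \<open>exp (- 1 / x)\<close>, extended by zero, is a linear combination of members of this family, so
  the span of the family is closed under differentiation and smoothness of all members follows by one induction.
\<close>

definition flat :: "nat \<Rightarrow> real \<Rightarrow> real" where
  "flat m x = (if x > 0 then inverse x ^ m * exp (- inverse x) else 0)"

lemma flat_tendsto_0: "flat m \<midarrow>0\<rightarrow> 0"
proof -
  have "((\<lambda>x. inverse x ^ m / exp (inverse x)) \<longlongrightarrow> 0) (at_right (0::real))"
    using filterlim_compose[OF tendsto_power_div_exp_0[of m] filterlim_inverse_at_top_right] by simp
  moreover have "eventually (\<lambda>x. inverse x ^ m / exp (inverse x) = flat m x) (at_right (0::real))"
    by (auto simp: flat_def exp_minus divide_inverse eventually_at_filter)
  ultimately have "(flat m \<longlongrightarrow> 0) (at_right 0)"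
    by (rule Lim_transform_eventually)
  moreover have "(flat m \<longlongrightarrow> 0) (at_left 0)"
    by (rule Lim_transform_eventually[OF tendsto_const])
       (auto simp: flat_def eventually_at_filter)
  ultimately show ?thesis
    by (simp add: filterlim_split_at)
qed

text \<open>
  At the origin, the difference quotient of \<open>flat m\<close> is \<open>flat (Suc m)\<close>, which tends to \<open>0\<close>.
\<close>

lemma flat_has_derivative:
  "(flat m has_real_derivative (flat (Suc (Suc m)) x - real m * flat (Suc m) x)) (at x)"
proof -
  consider "x > 0" | "x < 0" | "x = 0" by linarith
  then show ?thesis
  proof cases
    case 1
    have "((\<lambda>x. inverse x ^ m * exp (- inverse x)) has_real_derivative
       (flat (Suc (Suc m)) x - real m * flat (Suc m) x)) (at x)"
      using 1 by (auto intro!: derivative_eq_intros simp: flat_def algebra_simps)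
        (cases m; simp)
    then show ?thesis
      by (rule has_field_derivative_transform_within_open[where S = "{0<..}"])
         (use 1 in \<open>auto simp: flat_def\<close>)
  next
    case 2
    have "((\<lambda>x. 0) has_real_derivative 0) (at x)" by simp
    then have "(flat m has_real_derivative 0) (at x)"
      by (rule has_field_derivative_transform_within_open[where S = "{..<0}"])
         (use 2 in \<open>auto simp: flat_def\<close>)
    then show ?thesis using 2 by (simp add: flat_def)
  next
    case 3
    have "(\<lambda>h. (flat m (0 + h) - flat m 0) / h) \<midarrow>0\<rightarrow> 0"
      by (rule Lim_transform_eventually[OF flat_tendsto_0[of "Suc m"]])
         (auto simp: flat_def eventually_at_filter divide_inverse)
    then show ?thesis using 3 by (simp add: DERIV_def flat_def)
  qed
qed

lemma Ck_on_flat: "Ck_on k UNIV (flat m)"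
proof (induction k arbitrary: m)
  case 0
  have "isCont (flat m) x" for x
    using flat_has_derivative by (rule DERIV_isCont)
  then show ?case by (simp add: continuous_at_imp_continuous_on)
next
  case (Suc k)
  have "Ck_on k UNIV (\<lambda>x. flat (Suc (Suc m)) x + (- real m) * flat (Suc m) x)"
    by (intro Ck_on_add Ck_on_mult Ck_on_const Suc open_UNIV)
  then show ?case
    by (intro Ck_on_Suc_real[OF open_UNIV flat_has_derivative]) simp
qed

text \<open>
  The quotient \<open>f(x) / (f(x) + f(1 - x))\<close> of flat functions. Its derivative vanishes wherever
  the value \<open>0\<close> or \<open>1\<close> is attained, since these are extreme values; hence it is bounded by its maximum on \<open>[0, 1]\<close>.
\<close>

lemma smooth_step_exists:
  obtains s s' :: "real \<Rightarrow> real" and M :: real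
  where "\<And>k. Ck_on k UNIV s" "\<And>x. (s has_real_derivative s' x) (at x)"
    and "\<And>x. 0 \<le> s x" "\<And>x. s x \<le> 1" "\<And>x. x \<le> 0 \<Longrightarrow> s x = 0" "\<And>x. x \<ge> 1 \<Longrightarrow> s x = 1"
    and "\<And>x. x \<le> 0 \<Longrightarrow> s' x = 0" "\<And>x. x \<ge> 1 \<Longrightarrow> s' x = 0" "\<And>x. \<bar>s' x\<bar> \<le> M"
proof -
  define f where "f = flat 0"
  define s where "s x = f x * inverse (f x + f (1 - x))" for x
  define s' where "s' x = frechet_derivative s (at x) 1" for x
  have f0: "0 \<le> f x" "f x = 0 \<longleftrightarrow> x \<le> 0" for x
    by (auto simp: f_def flat_def)
  have pos: "0 < f x + f (1 - x)" for x
  proof (cases "x > 0")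
    case True
    then have "0 < f x" using f0[of x] by linarith
    then show ?thesis using f0(1)[of "1 - x"] by linarith
  next
    case False
    then have "0 < f (1 - x)" using f0[of "1 - x"] by linarith
    then show ?thesis using f0(1)[of x] by linarith
  qed
  have smooth: "Ck_on k UNIV s" for k
  proof -
    have "Ck_on k UNIV (\<lambda>x::real. 1 + - x)"
      by (intro Ck_on_add Ck_on_const Ck_on_bounded_linear open_UNIV
          bounded_linear_minus bounded_linear_ident)
    then have 1: "Ck_on k UNIV (\<lambda>x. f (1 - x))"
      unfolding f_def by (intro Ck_on_compose[OF open_UNIV open_UNIV Ck_on_flat]) auto
    have "Ck_on k UNIV (\<lambda>x. inverse (f x + f (1 - x)))"
      by (rule Ck_on_compose[OF open_UNIV _ Ck_on_inverse])
         (use pos 1 in \<open>auto intro!: Ck_on_add Ck_on_flat simp: f_def\<close>)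
    then show ?thesis
      unfolding s_def f_def by (intro Ck_on_mult Ck_on_flat open_UNIV)
  qed
  have deriv: "(s has_real_derivative s' x) (at x)" for x
  proof -
    have d: "(s has_derivative frechet_derivative s (at x)) (at x)"
      using Ck_on_Suc_has_derivative[OF smooth] by blast
    have "frechet_derivative s (at x) v = s' x * v" for v
      using linear_scale[OF has_derivative_linear[OF d], of v 1] by (simp add: s'_def)
    then have "frechet_derivative s (at x) = (*) (s' x)" by blast
    then show ?thesis using d by (simp add: has_field_derivative_def)
  qed
  have s0: "0 \<le> s x" and s1: "s x \<le> 1" for x
    using f0(1)[of x] f0(1)[of "1 - x"] pos[of x] by (auto simp: s_def field_simps)
  have sl: "s x = 0" if "x \<le> 0" for x
    using that f0 by (simp add: s_def)
  have sr: "s x = 1" if "x \<ge> 1" for x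
    using that f0(2)[of "1 - x"] f0(2)[of x] by (simp add: s_def)
  have s'l: "s' x = 0" if "x \<le> 0" for x
    by (rule DERIV_local_min[OF deriv[of x] zero_less_one]) (simp add: sl[OF that] s0)
  have s'r: "s' x = 0" if "x \<ge> 1" for x
    by (rule DERIV_local_max[OF deriv[of x] zero_less_one]) (simp add: sr[OF that] s1)
  have "continuous_on {0..1} s'"
    using smooth[of 1] unfolding s'_def by (auto intro: continuous_on_subset)
  then have "bounded (s' ` {0..1})"
    by (intro compact_imp_bounded compact_continuous_image) auto
  then obtain M where M: "\<And>x. x \<in> {0..1} \<Longrightarrow> norm (s' x) \<le> M"
    unfolding bounded_iff by blast
  have "\<bar>s' x\<bar> \<le> max M 0" for x
    using M[of x] s'l[of x] s'r[of x] by (cases "x \<in> {0..1}") auto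
  then show thesis
    using that[of s s' "max M 0"] smooth deriv s0 s1 sl sr s'l s'r by blast
qed

section \<open>A dilation-invariant measure and its shells\<close>

definition heis_dilation :: "real \<Rightarrow> 'n::finite heis \<Rightarrow> 'n heis" where
  "heis_dilation l p = (l *\<^sub>R fst p, l\<^sup>2 * snd p)"

text \<open>
  A dilation is diagonal in the standard basis; its determinant is \<open>l\<close> to the power \<open>Q\<close>.
\<close>

lemma nn_integral_heis_dilation:
  fixes f :: "'n::finite heis \<Rightarrow> ennreal"
  assumes f: "f \<in> borel_measurable borel" and l: "0 < l"
  shows "(\<integral>\<^sup>+ p. f p \<partial>lborel)
    = ennreal (l ^ (2 * CARD('n) + 2)) * (\<integral>\<^sup>+ p. f (heis_dilation l p) \<partial>lborel)"
proof -
  define c where "c b = (if snd b = 0 then l else l\<^sup>2)" for b :: "'n heis"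
  have c0: "c b \<noteq> 0" for b using l by (simp add: c_def)
  have T: "(\<lambda>p. 0 + (\<Sum>j\<in>Basis. (c j * (p \<bullet> j)) *\<^sub>R j)) = heis_dilation l"
  proof (rule ext, rule euclidean_eqI)
    fix p b :: "'n heis" assume b: "b \<in> Basis"
    then have "heis_dilation l p \<bullet> b = c b * (p \<bullet> b)"
      by (auto simp: Basis_prod_def heis_dilation_def c_def inner_prod_def)
    then show "(0 + (\<Sum>j\<in>Basis. (c j * (p \<bullet> j)) *\<^sub>R j)) \<bullet> b = heis_dilation l p \<bullet> b"
      using b by (simp add: inner_sum_left_Basis)
  qed
  have "(\<Prod>j\<in>Basis. \<bar>c j\<bar>)
    = (\<Prod>j\<in>(\<lambda>u. (u, 0)) ` (Basis :: (complex^'n) set). \<bar>c j\<bar>) * (\<Prod>j\<in>(\<lambda>v. (0, v)) ` (Basis :: real set). \<bar>c j\<bar>)"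
    unfolding Basis_prod_def by (intro prod.union_disjoint) auto
  also have "\<dots> = l ^ (2 * CARD('n) + 2)"
    using l by (subst (1 2) prod.reindex) (auto simp: inj_on_def c_def power_add mult.commute power2_eq_square)
  finally have P: "(\<Prod>j\<in>Basis. \<bar>c j\<bar>) = l ^ (2 * CARD('n) + 2)" .
  have L: "(lborel :: 'n heis measure) = density (distr lborel borel (heis_dilation l)) (\<lambda>_. ennreal (l ^ (2 * CARD('n) + 2)))"
    using lborel_affine_euclidean[of c 0] c0 unfolding T P by simp
  have m: "(heis_dilation l :: 'n heis \<Rightarrow> 'n heis) \<in> borel_measurable borel"
    unfolding heis_dilation_def[abs_def]
    by (intro borel_measurable_continuous_onI continuous_intros)
  have "(\<integral>\<^sup>+ p. f p \<partial>lborel)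
      = (\<integral>\<^sup>+ p. f p \<partial>density (distr lborel borel (heis_dilation l)) (\<lambda>_. ennreal (l ^ (2 * CARD('n) + 2))))"
    using L by simp
  also have "\<dots> = ennreal (l ^ (2 * CARD('n) + 2)) * (\<integral>\<^sup>+ p. f (heis_dilation l p) \<partial>lborel)"
    using f m by (simp add: nn_integral_density nn_integral_distr nn_integral_cmult)
  finally show ?thesis .
qed

lemma gauge4_dilation: "gauge4 (heis_dilation l p) = l ^ 4 * gauge4 p"
  by (simp add: gauge4_def heis_dilation_def power_mult_distrib algebra_simps flip: power_mult)

lemma continuous_on_gauge4: "continuous_on S (gauge4 :: 'n::finite heis \<Rightarrow> real)"
  using Ck_on_imp_continuous_on[OF Ck_on_gauge4] continuous_on_subset by blast

text \<open>
  The sublevel sets of the gauge are bounded because it dominates \<open>|z|\<^sup>4\<close> and \<open>t\<^sup>2\<close>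
  separately.
\<close>

lemma compact_gauge4_shell: "compact {p :: 'n::finite heis. a \<le> gauge4 p \<and> gauge4 p \<le> b}"
proof -
  have le: "x \<le> max 1 b" if "x ^ k \<le> b" "1 \<le> k" "0 \<le> x" for x :: real and k :: nat
  proof (cases "x \<le> 1")
    case False
    then have "x ^ 1 \<le> x ^ k" using that by (intro power_increasing) auto
    then show ?thesis using that by simp
  qed simp
  have "norm p \<le> 2 * max 1 b" if "gauge4 p \<le> b" for p :: "'n heis"
  proof -
    have "0 \<le> norm (fst p) ^ 4" "0 \<le> (snd p)\<^sup>2"
      by simp_all
    then have "norm (fst p) ^ 4 \<le> b" "\<bar>snd p\<bar> ^ 2 \<le> b"
      using that unfolding gauge4_def power2_abs by linarith+
    then have "norm (fst p) \<le> max 1 b" "\<bar>snd p\<bar> \<le> max 1 b"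
      using le[of "norm (fst p)" 4] le[of "\<bar>snd p\<bar>" 2] by auto
    moreover have "norm p \<le> norm (fst p) + \<bar>snd p\<bar>"
      using norm_Pair_le[of "fst p" "snd p"] by simp
    ultimately show ?thesis by linarith
  qed
  then have "bounded {p :: 'n heis. a \<le> gauge4 p \<and> gauge4 p \<le> b}"
    unfolding bounded_iff by blast
  moreover have "closed {p :: 'n heis. a \<le> gauge4 p \<and> gauge4 p \<le> b}"
    by (intro closed_Collect_conj closed_Collect_le continuous_on_gauge4 continuous_on_const)
  ultimately show ?thesis by (simp add: compact_eq_bounded_closed)
qed

definition log_gauge :: "'n::finite heis \<Rightarrow> real" where
  "log_gauge p = ln (gauge4 p) / 4"

definition shell :: "real \<Rightarrow> real \<Rightarrow> 'n::finite heis set" where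
  "shell a b = {p. p \<noteq> 0 \<and> a \<le> log_gauge p \<and> log_gauge p < b}"

text \<open>
  The function \<open>|z|\<^sup>2\<close> times \<open>\<rho>\<close> to the power \<open>- Q - 2\<close>. It is homogeneous of degree \<open>- Q\<close>, which compensates the
  Jacobian of the dilations.
\<close>

definition radial_density :: "'n::finite heis \<Rightarrow> real" where
  "radial_density p = gauge4 p powr (- (real CARD('n) + 2) / 2) * (norm (fst p))\<^sup>2"

definition radial_measure :: "'n::finite heis measure" where
  "radial_measure = density lborel (\<lambda>p. ennreal (radial_density p))"

lemma gauge4_measurable [measurable]: "gauge4 \<in> borel_measurable borel"
  by (rule borel_measurable_continuous_onI[OF continuous_on_gauge4])

lemma log_gauge_measurable [measurable]: "log_gauge \<in> borel_measurable borel"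
  unfolding log_gauge_def[abs_def] by measurable

lemma radial_density_measurable [measurable]:
  "(radial_density :: 'n::finite heis \<Rightarrow> real) \<in> borel_measurable borel"
proof -
  have [measurable]: "(\<lambda>p::'n heis. (norm (fst p))\<^sup>2) \<in> borel_measurable borel"
    by (intro borel_measurable_continuous_onI continuous_intros)
  show "(radial_density :: 'n heis \<Rightarrow> real) \<in> borel_measurable borel"
    unfolding radial_density_def[abs_def] by measurable
qed

lemma shell_measurable [measurable]: "(shell a b :: 'n::finite heis set) \<in> sets borel"
proof -
  have "shell a b = (- {0}) \<inter> {p :: 'n heis. a \<le> log_gauge p \<and> log_gauge p < b}"
    by (auto simp: shell_def)
  moreover have "{p :: 'n heis. a \<le> log_gauge p \<and> log_gauge p < b} \<in> sets borel"
    by measurable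
  ultimately show "(shell a b :: 'n heis set) \<in> sets borel" by auto
qed

lemma sets_radial_measure [measurable_cong, simp]: "sets radial_measure = sets borel"
  by (simp add: radial_measure_def)

lemma emeasure_radial_measure:
  "A \<in> sets borel \<Longrightarrow> emeasure radial_measure A = (\<integral>\<^sup>+ p. ennreal (radial_density p) * indicator A p \<partial>lborel)"
  unfolding radial_measure_def by (rule emeasure_density) auto

lemma radial_density_dilation:
  assumes "0 < l"
  shows "l ^ (2 * CARD('n::finite) + 2) * radial_density (heis_dilation l (p :: 'n heis)) = radial_density p"
proof -
  let ?n = "real CARD('n)" and ?e = "- (real CARD('n) + 2) / 2"
  have l4: "l ^ 4 = l powr 4" and l2: "l\<^sup>2 = l powr 2"
    using assms by (simp_all add: powr_numeral)
  have lQ: "l ^ (2 * CARD('n) + 2) = l powr (2 * ?n + 2)"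
    using powr_realpow[OF assms, of "2 * CARD('n) + 2"] by (simp add: algebra_simps)
  have e: "4 * ?e = - (2 * ?n + 4)"
    by simp
  have "(l ^ 4 * gauge4 p) powr ?e = (l powr 4) powr ?e * gauge4 p powr ?e"
    unfolding l4 by (rule powr_mult)
  also have "\<dots> = l powr (- (2 * ?n + 4)) * gauge4 p powr ?e"
    unfolding powr_powr e ..
  finally have N: "(l ^ 4 * gauge4 p) powr ?e = l powr (- (2 * ?n + 4)) * gauge4 p powr ?e" .
  have z: "(norm (fst (heis_dilation l p)))\<^sup>2 = l powr 2 * (norm (fst p))\<^sup>2"
    unfolding l2[symmetric] by (simp add: heis_dilation_def power_mult_distrib)
  have "l ^ (2 * CARD('n) + 2) * radial_density (heis_dilation l p)
      = (l powr (2 * ?n + 2) * l powr (- (2 * ?n + 4)) * l powr 2) * radial_density p"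
    unfolding radial_density_def gauge4_dilation N z lQ by (simp only: mult_ac)
  also have "l powr (2 * ?n + 2) * l powr (- (2 * ?n + 4)) * l powr 2 = 1"
    using assms by (simp add: powr_add[symmetric] del: powr_numeral)
  finally show ?thesis by simp
qed

text \<open>
  Invariance of the measure under the dilation with factor \<open>exp r\<close>, which shifts \<open>log_gauge\<close> by \<open>r\<close>.
\<close>

lemma emeasure_shell_shift:
  "emeasure radial_measure (shell (a + r) (b + r) :: 'n heis set) = emeasure radial_measure (shell a b :: 'n::finite heis set)"
proof -
  let ?l = "exp r" and ?Q = "2 * CARD('n) + 2"
  have ind: "indicator (shell (a + r) (b + r)) (heis_dilation ?l p) = (indicator (shell a b) p :: ennreal)"
    for p :: "'n heis"
  proof -
    have "heis_dilation ?l p = 0 \<longleftrightarrow> p = 0"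
      by (auto simp: heis_dilation_def prod_eq_iff)
    moreover have "log_gauge (heis_dilation ?l p) = log_gauge p + r" if "p \<noteq> 0"
    proof -
      have "ln (exp r ^ 4) = 4 * r" by (simp add: ln_realpow)
      then show ?thesis
        using gauge4_pos[OF that] by (simp add: log_gauge_def gauge4_dilation ln_mult add_divide_distrib)
    qed
    ultimately show ?thesis
      by (auto simp: indicator_def shell_def)
  qed
  have "emeasure radial_measure (shell (a + r) (b + r) :: 'n heis set)
    = ennreal (?l ^ ?Q) * (\<integral>\<^sup>+ p. ennreal (radial_density (heis_dilation ?l p))
        * indicator (shell (a + r) (b + r)) (heis_dilation ?l (p :: 'n heis)) \<partial>lborel)"
    by (subst emeasure_radial_measure, simp, rule nn_integral_heis_dilation) auto
  also have "\<dots> = (\<integral>\<^sup>+ p. ennreal (?l ^ ?Q) * (ennreal (radial_density (heis_dilation ?l p))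
        * indicator (shell a b) (p :: 'n heis)) \<partial>lborel)"
    unfolding ind
  proof (rule nn_integral_cmult[symmetric])
    have [measurable]: "(heis_dilation ?l :: 'n heis \<Rightarrow> _) \<in> borel_measurable borel"
      unfolding heis_dilation_def[abs_def]
      by (intro borel_measurable_continuous_onI continuous_intros)
    show "(\<lambda>p :: 'n heis. ennreal (radial_density (heis_dilation ?l p)) * indicator (shell a b) p)
        \<in> borel_measurable lborel"
      by measurable
  qed
  also have "\<dots> = (\<integral>\<^sup>+ p. ennreal (radial_density p) * indicator (shell a b) (p :: 'n heis) \<partial>lborel)"
    by (simp only: mult.assoc[symmetric] ennreal_mult'[symmetric] zero_le_power exp_ge_zero
        radial_density_dilation[OF exp_gt_zero])
  also have "\<dots> = emeasure radial_measure (shell a b :: 'n heis set)"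
    by (simp add: emeasure_radial_measure)
  finally show ?thesis .
qed

lemma emeasure_shell_nat:
  "emeasure radial_measure (shell 0 (real k) :: 'n::finite heis set)
    = of_nat k * emeasure radial_measure (shell 0 1 :: 'n heis set)"
proof (induction k)
  case 0
  have "shell 0 0 = ({} :: 'n heis set)" by (auto simp: shell_def)
  then show ?case by simp
next
  case (Suc k)
  have "shell 0 (real (Suc k)) = shell 0 (real k) \<union> (shell (real k) (real (Suc k)) :: 'n heis set)"
    by (auto simp: shell_def)
  moreover have "shell 0 (real k) \<inter> (shell (real k) (real (Suc k)) :: 'n heis set) = {}"
    by (auto simp: shell_def)
  ultimately have "emeasure radial_measure (shell 0 (real (Suc k)) :: 'n heis set)
      = emeasure radial_measure (shell 0 (real k) :: 'n heis set)
        + emeasure radial_measure (shell (real k) (real (Suc k)) :: 'n heis set)"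
    by (simp add: plus_emeasure)
  also have "emeasure radial_measure (shell (real k) (real (Suc k)) :: 'n heis set)
      = emeasure radial_measure (shell 0 1 :: 'n heis set)"
    using emeasure_shell_shift[of 0 "real k" 1] by (simp add: add.commute)
  finally show ?case by (simp add: Suc algebra_simps)
qed

lemma shell_bounds:
  assumes "p \<noteq> 0"
  shows "a \<le> log_gauge p \<longleftrightarrow> exp (4 * a) \<le> gauge4 p" "log_gauge p < b \<longleftrightarrow> gauge4 p < exp (4 * b)"
    "log_gauge p \<le> b \<longleftrightarrow> gauge4 p \<le> exp (4 * b)" "a < log_gauge p \<longleftrightarrow> exp (4 * a) < gauge4 p"
proof -
  have e: "gauge4 p = exp (4 * log_gauge p)"
    using gauge4_pos[OF assms] by (simp add: log_gauge_def)
  show "a \<le> log_gauge p \<longleftrightarrow> exp (4 * a) \<le> gauge4 p" "log_gauge p < b \<longleftrightarrow> gauge4 p < exp (4 * b)"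
    "log_gauge p \<le> b \<longleftrightarrow> gauge4 p \<le> exp (4 * b)" "a < log_gauge p \<longleftrightarrow> exp (4 * a) < gauge4 p"
    unfolding e by simp_all
qed

lemma emeasure_shell_finite: "emeasure radial_measure (shell a b :: 'n::finite heis set) < \<infinity>"
proof -
  let ?K = "{p :: 'n heis. exp (4 * a) \<le> gauge4 p \<and> gauge4 p \<le> exp (4 * b)}"
  have sub: "?K \<subseteq> - {0}"
    by (auto simp: gauge4_def zero_prod_def)
  have "continuous_on ?K radial_density"
    unfolding radial_density_def[abs_def]
    by (intro continuous_on_mult continuous_on_subset[OF Ck_on_imp_continuous_on[OF Ck_on_gauge4_powr[of 0]] sub]
        continuous_intros)
  then have "integrable lborel (\<lambda>p. indicator ?K p *\<^sub>R radial_density p)"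
    by (rule borel_integrable_compact[OF compact_gauge4_shell])
  then have fin: "(\<integral>\<^sup>+ p. ennreal (norm (indicator ?K p *\<^sub>R radial_density p)) \<partial>lborel) < \<infinity>"
    by (simp add: integrable_iff_bounded)
  have "emeasure radial_measure (shell a b :: 'n heis set)
     \<le> (\<integral>\<^sup>+ p. ennreal (norm (indicator ?K p *\<^sub>R radial_density p)) \<partial>lborel)"
    unfolding emeasure_radial_measure[OF shell_measurable]
    by (intro nn_integral_mono)
       (auto simp: indicator_def shell_def shell_bounds radial_density_def)
  with fin show ?thesis by simp
qed

text \<open>
  The density vanishes only on the null set \<open>z = 0\<close>, and off that set the shell contains a nonempty open set.
\<close>

lemma emeasure_shell_pos: "0 < emeasure radial_measure (shell 0 1 :: 'n::finite heis set)"
proof (rule ccontr)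
  assume "\<not> ?thesis"
  then have "(\<integral>\<^sup>+ p. ennreal (radial_density p) * indicator (shell 0 1) (p :: 'n heis) \<partial>lborel) = 0"
    by (simp add: emeasure_radial_measure)
  then have ae: "AE p in lborel. ennreal (radial_density p) * indicator (shell 0 1) (p :: 'n heis) = 0"
    by (subst (asm) nn_integral_0_iff_AE) auto
  define O' where "O' = {p :: 'n heis. fst p \<noteq> 0 \<and> 1 < gauge4 p \<and> gauge4 p < exp 4}"
  have op: "open O'"
    unfolding O'_def
    by (intro open_Collect_conj open_Collect_less open_Collect_neq continuous_on_gauge4 continuous_intros)
  have "ennreal (radial_density p) * indicator (shell 0 1) p \<noteq> 0" if "p \<in> O'" for p
  proof -
    have p: "p \<noteq> 0" "fst p \<noteq> 0" using that by (auto simp: O'_def)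
    moreover have "p \<in> shell 0 1"
      using that p by (auto simp: O'_def shell_def shell_bounds)
    ultimately show ?thesis
      using gauge4_pos[of p] by (simp add: radial_density_def)
  qed
  with ae have "AE p in lborel. p \<notin> O'" by fastforce
  then have "O' \<in> null_sets lborel"
    using op by (simp add: AE_iff_null_sets)
  then have "negligible O'"
    by (simp add: negligible_iff_null_sets null_sets_completionI)
  then have "O' = {}"
    using op open_not_negligible by blast
  \<comment> \<open>Here \<open>|z|\<^sup>4 = exp 2\<close>, strictly between the bounds \<open>1\<close> and \<open>exp 4\<close> of the shell.\<close>
  moreover have "(axis undefined (of_real (exp (1/2))), 0) \<in> O'"
  proof -
    have "norm (axis (undefined::'n) (of_real (exp (1/2)) :: complex)) = exp (1/2)"
      unfolding norm_eq_sqrt_inner inner_axis_axis by (simp add: inner_complex_def flip: power2_eq_square)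
    moreover have "exp (1/2) ^ 4 = exp (2::real)"
      by (simp flip: exp_of_nat_mult)
    ultimately show ?thesis
      by (auto simp: O'_def gauge4_def)
  qed
  ultimately show False by blast
qed

section \<open>Radial test functions and sharpness\<close>

lemma heis_grad_radial:
  fixes f :: "'n::finite heis \<Rightarrow> real"
  assumes p: "p \<noteq> 0" and h: "(h has_real_derivative h') (at (log_gauge p))"
    and f: "\<And>q. q \<noteq> 0 \<Longrightarrow> f q = h (log_gauge q)"
  shows "heis_grad f p = (h' / gauge4 p) *\<^sub>R gauge_dir p"
proof -
  let ?N' = "\<lambda>v. 4 * (norm (fst p))\<^sup>2 * (fst p \<bullet> fst v) + 2 * snd p * snd v"
  have "((\<lambda>x. ln x / 4) has_real_derivative inverse (gauge4 p) / 4) (at (gauge4 p))"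
    by (rule DERIV_cdivide[OF DERIV_ln[OF gauge4_pos[OF p]]])
  then have "(log_gauge has_derivative (\<lambda>v. ?N' v * (inverse (gauge4 p) / 4))) (at p)"
    unfolding log_gauge_def[abs_def] by (rule DERIV_compose_FDERIV[OF _ gauge4_has_derivative])
  then have "((\<lambda>q. h (log_gauge q)) has_derivative (\<lambda>v. ?N' v * (inverse (gauge4 p) / 4) * h')) (at p)"
    by (rule DERIV_compose_FDERIV[where g = log_gauge, OF h])
  then have "(f has_derivative (\<lambda>v. ?N' v * (inverse (gauge4 p) / 4) * h')) (at p)"
    by (rule has_derivative_transform_within_open[where s = "- {0}"]) (simp_all add: p f open_Compl)
  then have D: "frechet_derivative f (at p) = (\<lambda>v. ?N' v * (inverse (gauge4 p) / 4) * h')"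
    by (rule frechet_derivative_at[symmetric])
  have ax: "fst p \<bullet> axis j 1 = Re (fst p $ j)" "fst p \<bullet> axis j \<i> = Im (fst p $ j)" for j
    by (simp_all add: inner_axis inner_complex_def)
  have "heis_X j f p = h' / gauge4 p * ((norm (fst p))\<^sup>2 * Re (fst p $ j) + snd p * Im (fst p $ j))"
    and "heis_Y j f p = h' / gauge4 p * ((norm (fst p))\<^sup>2 * Im (fst p $ j) - snd p * Re (fst p $ j))" for j
    unfolding heis_X_def heis_Y_def partial_x_def partial_y_def partial_t_def D fst_conv snd_conv ax
      divide_inverse
    by (simp_all add: algebra_simps)
  then show ?thesis
    by (simp add: heis_grad_def gauge_dir_def vec_eq_iff)
qed

text \<open>
  The exponent bookkeeping: the factor \<open>exp (- c L)\<close> in the test functions turns the weight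
  \<open>\<rho>\<^sup>\<alpha> |z|\<^sup>2 / \<rho>\<^sup>4\<close>, common to both integrals of radial functions, into the dilation-invariant density.
\<close>

lemma radial_weight:
  fixes p :: "'n::finite heis"
  assumes p: "p \<noteq> 0" and c: "c = (2 * real CARD('n) + \<alpha>) / 2"
  shows "heis_norm p powr \<alpha> * (exp (- c * log_gauge p))\<^sup>2 / gauge4 p * (norm (fst p))\<^sup>2 = radial_density p"
proof -
  note N = gauge4_pos[OF p]
  have "(exp (- c * log_gauge p))\<^sup>2 = gauge4 p powr (- c / 2)"
    using N by (simp add: powr_def log_gauge_def flip: exp_of_nat_mult)
  then have "heis_norm p powr \<alpha> * (exp (- c * log_gauge p))\<^sup>2 / gauge4 p
      = gauge4 p powr (\<alpha> / 4) * gauge4 p powr (- c / 2) / gauge4 p powr 1"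
    using N by (simp add: heis_norm_powr)
  also have "\<dots> = gauge4 p powr (\<alpha> / 4 + - c / 2 - 1)"
    by (simp only: powr_add powr_diff)
  also have "\<alpha> / 4 + - c / 2 - 1 = - (real CARD('n) + 2) / 2"
    by (simp add: c field_simps)
  finally show ?thesis
    by (simp add: radial_density_def)
qed

lemma Ck_on_log_gauge: "Ck_on k (- {0}) (log_gauge :: 'n::finite heis \<Rightarrow> real)"
proof -
  have "Ck_on k (- {0}) (\<lambda>p :: 'n heis. ln (gauge4 p) * (1 / 4))"
    by (intro Ck_on_mult Ck_on_const Ck_on_compose[OF _ _ Ck_on_ln Ck_on_subset[OF Ck_on_gauge4] gauge4_image])
       auto
  then show ?thesis by (simp add: log_gauge_def[abs_def])
qed

text \<open>
  The value at the origin is prescribed separately because \<open>ln 0 = 0\<close> would otherwise give \<open>h 0\<close> there. The support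
  lies in a compact shell on which the gauge is bounded away from zero.
\<close>

lemma radial_in_C0_infinity:
  fixes h :: "real \<Rightarrow> real"
  assumes h: "\<And>k. Ck_on k UNIV h" and supp: "\<And>x. x < a \<or> b < x \<Longrightarrow> h x = 0"
  shows "(\<lambda>p :: 'n::finite heis. if p = 0 then 0 else h (log_gauge p)) \<in> C0_infinity (- {0})"
proof -
  let ?f = "\<lambda>p :: 'n heis. if p = 0 then 0 else h (log_gauge p)"
  let ?K = "{p :: 'n heis. exp (4 * a) \<le> gauge4 p \<and> gauge4 p \<le> exp (4 * b)}"
  have smooth: "Ck_on k (- {0}) ?f" for k
  proof -
    have "Ck_on k (- {0}) (\<lambda>p :: 'n heis. h (log_gauge p))"
      by (rule Ck_on_compose[OF _ open_UNIV h Ck_on_log_gauge]) auto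
    then show ?thesis
      by (subst Ck_on_cong[where g = "\<lambda>p. h (log_gauge p)"]) auto
  qed
  have "p \<in> ?K" if "?f p \<noteq> 0" for p
  proof -
    have p: "p \<noteq> 0" "h (log_gauge p) \<noteq> 0"
      using that by (auto split: if_splits)
    then have "a \<le> log_gauge p" "log_gauge p \<le> b"
      using supp[of "log_gauge p"] by force+
    then show ?thesis
      using p(1) by (simp add: shell_bounds)
  qed
  then have sub: "closure {p. ?f p \<noteq> 0} \<subseteq> ?K"
    by (intro closure_minimal compact_imp_closed[OF compact_gauge4_shell]) blast
  moreover have "?K \<subseteq> - {0}"
    by (auto simp: gauge4_def zero_prod_def)
  moreover have "compact (closure {p. ?f p \<noteq> 0})"
    using compact_Int_closed[OF compact_gauge4_shell closed_closure, of "exp (4 * a)" "exp (4 * b)"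
        "{p. ?f p \<noteq> 0}"]
    unfolding Int_absorb1[OF sub] .
  ultimately show ?thesis
    using smooth unfolding C0_infinity_def by blast
qed

lemma nn_integral_radial_measure:
  "g \<in> borel_measurable borel \<Longrightarrow>
    (\<integral>\<^sup>+ p. g p \<partial>radial_measure) = (\<integral>\<^sup>+ p. ennreal (radial_density p) * g p \<partial>lborel)"
  unfolding radial_measure_def by (rule nn_integral_density) auto

text \<open>
  With the plateau \<open>u(x) = s(x + 1) s(k + 1 - x)\<close> the energy is at most \<open>(c\<^sup>2 k + 2 B) \<mu>\<close> and the potential at least
  \<open>k \<mu>\<close>, where \<open>\<mu>\<close> is the mass of a unit shell and \<open>B\<close> bounds \<open>(u' - c u)\<^sup>2\<close>. Any admissible constant
  \<open>C\<close> therefore satisfies \<open>C k \<le> c\<^sup>2 k + 2 B\<close>, which fails for large \<open>k\<close> when \<open>C > c\<^sup>2\<close>.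
\<close>

lemma hardy_constant_sharp:
  fixes \<alpha> C :: real
  defines "c \<equiv> (2 * real CARD('n::finite) + \<alpha>) / 2"
  assumes C: "c\<^sup>2 < C"
  shows "\<exists>\<phi> \<in> C0_infinity (- {0} :: 'n heis set). \<not> ennreal C * hardy_potential \<alpha> \<phi> \<le> hardy_energy \<alpha> \<phi>"
proof -
  obtain s s' :: "real \<Rightarrow> real" and M :: real
    where s: "\<And>k. Ck_on k UNIV s" "\<And>x. (s has_real_derivative s' x) (at x)"
      "\<And>x. 0 \<le> s x" "\<And>x. s x \<le> 1" "\<And>x. x \<le> 0 \<Longrightarrow> s x = 0" "\<And>x. x \<ge> 1 \<Longrightarrow> s x = 1"
      "\<And>x. x \<le> 0 \<Longrightarrow> s' x = 0" "\<And>x. x \<ge> 1 \<Longrightarrow> s' x = 0" "\<And>x. \<bar>s' x\<bar> \<le> M"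
    using smooth_step_exists by metis
  define B where "B = (2 * M + \<bar>c\<bar>)\<^sup>2"
  have B0: "0 \<le> B" by (simp add: B_def)
  \<comment> \<open>The plateau must be long enough for its energy gap \<open>(C - c\<^sup>2) k\<close> to outweigh the two transition shells.\<close>
  obtain k :: nat where k: "2 * B / (C - c\<^sup>2) < real k"
    using reals_Archimedean2 by blast
  define u where "u x = s (x + 1) * s (real k + 1 - x)" for x
  define u' where "u' x = s' (x + 1) * s (real k + 1 - x) - s (x + 1) * s' (real k + 1 - x)" for x
  define h where "h x = exp (- c * x) * u x" for x
  \<comment> \<open>The factor that remains of \<open>h'\<close> after splitting off the exponential.\<close>
  define v where "v x = u' x - c * u x" for x
  have du: "(u has_real_derivative u' x) (at x)" for x
    unfolding u_def[abs_def] u'_def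
    by (auto intro!: derivative_eq_intros DERIV_chain2[OF s(2)])
  have dh: "(h has_real_derivative exp (- c * x) * v x) (at x)" for x
    unfolding h_def[abs_def] v_def
    by (auto intro!: derivative_eq_intros du simp: algebra_simps)
  have smooth: "Ck_on j UNIV h" for j
  proof -
    have lin: "Ck_on j UNIV (\<lambda>x::real. b * x + d)" for b d
      by (intro Ck_on_add Ck_on_mult Ck_on_const Ck_on_bounded_linear bounded_linear_ident open_UNIV)
    have "Ck_on j UNIV (\<lambda>x. exp (- c * x + 0) * (s (1 * x + 1) * s (- 1 * x + (real k + 1))))"
      by (intro Ck_on_mult open_UNIV Ck_on_compose[OF open_UNIV open_UNIV Ck_on_exp lin]
          Ck_on_compose[OF open_UNIV open_UNIV s(1) lin]) auto
    then show ?thesis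
      by (simp add: h_def[abs_def] u_def algebra_simps)
  qed
  have v_out: "v x = 0" "u x = 0" if "x < - 1 \<or> real k + 1 \<le> x" for x
    using that s(5)[of "x + 1"] s(7)[of "x + 1"] s(5)[of "real k + 1 - x"] s(7)[of "real k + 1 - x"]
    by (auto simp: v_def u_def u'_def)
  have v_in: "v x = - c" "u x = 1" if "0 \<le> x" "x < real k" for x
    using that s(6)[of "x + 1"] s(8)[of "x + 1"] s(6)[of "real k + 1 - x"] s(8)[of "real k + 1 - x"]
    by (auto simp: v_def u_def u'_def)
  have v_le: "(v x)\<^sup>2 \<le> B" for x
  proof -
    have s_abs: "\<bar>s y\<bar> \<le> 1" for y using s(3,4)[of y] by simp
    have "\<bar>u' x\<bar> \<le> \<bar>s' (x + 1)\<bar> * \<bar>s (real k + 1 - x)\<bar> + \<bar>s (x + 1)\<bar> * \<bar>s' (real k + 1 - x)\<bar>"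
      unfolding u'_def by (simp add: abs_mult[symmetric])
    also have "\<dots> \<le> M * 1 + 1 * M"
      using s(9)[of 0] by (intro add_mono mult_mono s(9) s_abs) auto
    finally have "\<bar>u' x\<bar> \<le> 2 * M" by simp
    moreover have "\<bar>c * u x\<bar> \<le> \<bar>c\<bar>"
      using mult_mono[OF s_abs[of "x + 1"] s_abs[of "real k + 1 - x"]]
        mult_left_mono[of "\<bar>u x\<bar>" 1 "\<bar>c\<bar>"] by (simp add: u_def abs_mult)
    ultimately have "\<bar>v x\<bar> \<le> 2 * M + \<bar>c\<bar>"
      unfolding v_def by linarith
    then show ?thesis
      unfolding B_def by (rule abs_le_square_iff[THEN iffD1, OF order_trans]) simp
  qed
  define \<phi> where "\<phi> = (\<lambda>p :: 'n heis. if p = 0 then 0 else h (log_gauge p))"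
  have \<phi>: "\<phi> \<in> C0_infinity (- {0})"
    unfolding \<phi>_def
    by (rule radial_in_C0_infinity[OF smooth, of "- 1" "real k + 1"]) (auto simp: h_def v_out)
  have energy_eq: "heis_norm p powr \<alpha> * (norm (heis_grad \<phi> p))\<^sup>2 = radial_density p * (v (log_gauge p))\<^sup>2"
    if p: "p \<noteq> 0" for p :: "'n heis"
  proof -
    have "heis_grad \<phi> p = (exp (- c * log_gauge p) * v (log_gauge p) / gauge4 p) *\<^sub>R gauge_dir p"
      by (rule heis_grad_radial[OF p dh]) (simp add: \<phi>_def)
    then have "(norm (heis_grad \<phi> p))\<^sup>2
        = (exp (- c * log_gauge p) * v (log_gauge p) / gauge4 p)\<^sup>2 * ((norm (fst p))\<^sup>2 * gauge4 p)"
      by (simp only: norm_scaleR power_mult_distrib power2_abs norm_gauge_dir)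
    also have "\<dots> = (exp (- c * log_gauge p))\<^sup>2 / gauge4 p * (norm (fst p))\<^sup>2 * (v (log_gauge p))\<^sup>2"
      using gauge4_pos[OF p] by (simp add: power2_eq_square)
    finally show ?thesis
      unfolding radial_weight[OF p c_def[THEN meta_eq_to_obj_eq], symmetric] by simp
  qed
  have potential_eq: "heis_norm p powr \<alpha> * ((norm (fst p))\<^sup>2 / heis_norm p ^ 4) * (\<phi> p)\<^sup>2
      = radial_density p * (u (log_gauge p))\<^sup>2" if p: "p \<noteq> 0" for p :: "'n heis"
    unfolding radial_weight[OF p c_def[THEN meta_eq_to_obj_eq], symmetric]
    using p by (simp add: heis_norm_power4 \<phi>_def h_def power_mult_distrib)
  define m where "m = emeasure radial_measure (shell 0 1 :: 'n heis set)"
  obtain \<mu> where m: "m = ennreal \<mu>" "0 < \<mu>"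
    using emeasure_shell_finite[of 0 1, where 'n = 'n] emeasure_shell_pos[where 'n = 'n]
    unfolding m_def[symmetric] by (cases m) auto
  have shells: "emeasure radial_measure (shell 0 (real k) :: 'n heis set) = ennreal (real k * \<mu>)"
      "emeasure radial_measure (shell (- 1) 0 :: 'n heis set) = ennreal \<mu>"
      "emeasure radial_measure (shell (real k) (real k + 1) :: 'n heis set) = ennreal \<mu>"
    using emeasure_shell_nat[of k, where 'n = 'n] emeasure_shell_shift[of "-1" 1 0, where 'n = 'n]
      emeasure_shell_shift[of 0 "real k" 1, where 'n = 'n] m
    by (simp_all add: m_def add.commute ennreal_mult' ennreal_of_nat_eq_real_of_nat)
  let ?g = "\<lambda>p :: 'n heis. ennreal (c\<^sup>2) * indicator (shell 0 (real k)) p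
      + ennreal B * indicator (shell (- 1) 0) p + ennreal B * indicator (shell (real k) (real k + 1)) p"
  have "hardy_energy \<alpha> \<phi> \<le> (\<integral>\<^sup>+ p. ennreal (radial_density p) * ?g p \<partial>lborel)"
    unfolding hardy_energy_def
  proof (rule nn_integral_mono)
    fix p :: "'n heis"
    show "ennreal (heis_norm p powr \<alpha> * (norm (heis_grad \<phi> p))\<^sup>2) \<le> ennreal (radial_density p) * ?g p"
    proof (cases "p = 0")
      case True
      then show ?thesis by (simp add: heis_norm_def)
    next
      case False
      let ?L = "log_gauge p"
      have "ennreal ((v ?L)\<^sup>2) \<le> ?g p"
      proof -
        consider "?L < - 1 \<or> real k + 1 \<le> ?L" | "- 1 \<le> ?L" "?L < 0" | "0 \<le> ?L" "?L < real k"
          | "real k \<le> ?L" "?L < real k + 1" by linarith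
        then show ?thesis
        proof cases
          case 1
          then show ?thesis by (simp add: v_out)
        next
          case 2
          then have "?g p = ennreal B"
            using False by (simp add: shell_def)
          then show ?thesis using v_le by (simp add: ennreal_leI)
        next
          case 3
          then have "?g p = ennreal (c\<^sup>2)"
            using False by (simp add: shell_def)
          then show ?thesis using 3 by (simp add: v_in)
        next
          case 4
          then have "?g p = ennreal B"
            using False by (simp add: shell_def)
          then show ?thesis using v_le by (simp add: ennreal_leI)
        qed
      qed
      then have "ennreal (radial_density p) * ennreal ((v ?L)\<^sup>2) \<le> ennreal (radial_density p) * ?g p"
        by (rule mult_left_mono) simp
      then show ?thesis
        unfolding energy_eq[OF False] by (simp add: ennreal_mult'')
    qed
  qed
  also have "\<dots> = (\<integral>\<^sup>+ p. ?g p \<partial>radial_measure)"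
    by (rule nn_integral_radial_measure[symmetric]) measurable
  also have "\<dots> = ennreal (c\<^sup>2) * ennreal (real k * \<mu>) + ennreal B * ennreal \<mu> + ennreal B * ennreal \<mu>"
    by (simp add: nn_integral_add nn_integral_cmult_indicator shells)
  also have "\<dots> = ennreal ((c\<^sup>2 * real k + 2 * B) * \<mu>)"
    using B0 m(2) by (simp add: ennreal_mult'[symmetric] ennreal_plus[symmetric] algebra_simps del: ennreal_plus)
  finally have energy: "hardy_energy \<alpha> \<phi> \<le> ennreal ((c\<^sup>2 * real k + 2 * B) * \<mu>)" .
  have "ennreal (real k * \<mu>) = (\<integral>\<^sup>+ p. ennreal (radial_density p) * indicator (shell 0 (real k)) (p :: 'n heis) \<partial>lborel)"
    using shells(1) by (simp add: emeasure_radial_measure)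
  also have "\<dots> \<le> hardy_potential \<alpha> \<phi>"
    unfolding hardy_potential_def
  proof (rule nn_integral_mono)
    fix p :: "'n heis"
    show "ennreal (radial_density p) * indicator (shell 0 (real k)) p
      \<le> ennreal (heis_norm p powr \<alpha> * ((norm (fst p))\<^sup>2 / heis_norm p ^ 4) * (\<phi> p)\<^sup>2)"
      using potential_eq[of p] by (auto simp: shell_def v_in indicator_def)
  qed
  finally have potential: "ennreal (real k * \<mu>) \<le> hardy_potential \<alpha> \<phi>" .
  have "\<not> ennreal C * hardy_potential \<alpha> \<phi> \<le> hardy_energy \<alpha> \<phi>"
  proof
    assume *: "ennreal C * hardy_potential \<alpha> \<phi> \<le> hardy_energy \<alpha> \<phi>"
    have C0: "0 < C" using C zero_le_power2[of c] by linarith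
    have "ennreal (C * (real k * \<mu>)) = ennreal C * ennreal (real k * \<mu>)"
      using C0 by (simp add: ennreal_mult')
    also have "\<dots> \<le> ennreal C * hardy_potential \<alpha> \<phi>"
      by (rule mult_left_mono[OF potential]) simp
    also have "\<dots> \<le> ennreal ((c\<^sup>2 * real k + 2 * B) * \<mu>)"
      using * energy by (rule order_trans)
    finally have "C * (real k * \<mu>) \<le> (c\<^sup>2 * real k + 2 * B) * \<mu>"
      using B0 m(2) by (subst (asm) ennreal_le_iff) auto
    then have "C * real k \<le> c\<^sup>2 * real k + 2 * B"
      using m(2) by (simp add: mult.assoc[symmetric])
    moreover have "2 * B < real k * (C - c\<^sup>2)"
      using k C by (simp add: pos_divide_less_eq)
    ultimately show False
      by (simp add: algebra_simps)
  qed
  with \<phi> show ?thesis by blast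
qed

theorem theorem3p1:
  fixes \<alpha> Q :: real
  assumes Q: "Q = 2 * real CARD('n::finite) + 2"
  shows "(\<forall>\<phi> \<in> C0_infinity (- {(0, 0)} :: 'n heis set).
            hardy_energy \<alpha> \<phi> \<ge> ennreal (((Q + \<alpha> - 2) / 2)\<^sup>2) * hardy_potential \<alpha> \<phi>)
       \<and> (\<forall>C :: real. C > ((Q + \<alpha> - 2) / 2)\<^sup>2 \<longrightarrow>
            \<not> (\<forall>\<phi> \<in> C0_infinity (- {(0, 0)} :: 'n heis set).
                  hardy_energy \<alpha> \<phi> \<ge> ennreal C * hardy_potential \<alpha> \<phi>))"
proof -
  have c: "(Q + \<alpha> - 2) / 2 = (2 * real CARD('n) + \<alpha>) / 2"
    by (simp add: Q)
  show ?thesis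
    unfolding c zero_prod_def[symmetric]
    using hardy_inequality[where 'n = 'n] hardy_constant_sharp[where 'n = 'n] by blast
qed

end
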